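(* Let $\phi(z)=\sum_{n\ge1,\ n\text{ odd}}a(n)q_z^n$ be the Fourier expansion at $i\infty$ of $$\phi(z)=(\eta(2z)\eta(4z))^4\,\frac{1-96\psi(2z)+256\psi(2z)^2}{(1+16\psi(2z))^2},\qquad \psi(z)=\frac{\eta(z)^8\eta(4z)^{16}}{\eta(2z)^{24}}.$$ Then $p^3\mid (a(p)-p)$ for every odd prime $p$.
   Context: Here $z$ lies in the upper half plane, $q_z=e^{2\pi i z}$, and $\eta(z)=q_z^{1/24}\prod_{n\ge1}(1-q_z^n)$ is the Dedekind eta function. The coefficients $a(n)$ are integers. *)

theory Defs
  imports "HOL-Complex_Analysis.Complex_Analysis" "HOL-Computational_Algebra.Primes"
begin

definition qz :: "complex \<Rightarrow> complex" where
  "qz z = exp (2 * of_real pi * \<i> * z)"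

text \<open>The factor \<open>exp (2 * pi * \<i> * z / 24)\<close> is the usual single-valued choice of the
  24th root of \<open>qz z\<close>. The product only converges for \<open>z\<close> in the upper half plane;
  elsewhere the value is junk.\<close>

definition dedekind_eta :: "complex \<Rightarrow> complex" where
  "dedekind_eta z = exp (2 * of_real pi * \<i> * z / 24) * (\<Prod>n. 1 - qz z ^ Suc n)"

definition psi :: "complex \<Rightarrow> complex" where
  "psi z = dedekind_eta z ^ 8 * dedekind_eta (4 * z) ^ 16 / dedekind_eta (2 * z) ^ 24"

definition phi :: "complex \<Rightarrow> complex" where
  "phi z = (dedekind_eta (2 * z) * dedekind_eta (4 * z)) ^ 4 *
     ((1 - 96 * psi (2 * z) + 256 * psi (2 * z) ^ 2) / (1 + 16 * psi (2 * z)) ^ 2)"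

text \<open>\<open>f\<close> has the expansion \<open>\<Sum>n\<in>A. a n * qz z ^ n\<close> near \<open>i\<infinity>\<close>. Equality is only required for all
  \<open>z\<close> of sufficiently large imaginary part: the function \<open>phi\<close> above has poles in the upper half
  plane (where \<open>psi (2 * z) = -1/16\<close>), so its expansion does not converge on all of it.\<close>

definition has_fourier_expansion_at_ii_inf ::
    "(complex \<Rightarrow> complex) \<Rightarrow> (nat \<Rightarrow> complex) \<Rightarrow> nat set \<Rightarrow> bool" where
  "has_fourier_expansion_at_ii_inf f a A \<longleftrightarrow>
     (\<exists>Y. \<forall>z. Im z > Y \<longrightarrow> ((\<lambda>n. a n * qz z ^ n) has_sum f z) A)"

end

theory Submission
  imports Defs "HOL-Number_Theory.Cong"
begin

text \<open>
  Put \<open>D = x d/dx\<close> in the variable \<open>x = qz z\<close>, let \<open>a = \<theta>\<^sub>3\<^sup>2\<close>, \<open>c = \<theta>\<^sub>2\<^sup>2\<close> at the nome \<open>x\<^sup>2\<close>, and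
  \<open>Z = a\<^sup>2 + c\<^sup>2\<close>. Since \<open>16 \<psi>(2z) = c\<^sup>2/a\<^sup>2\<close>, one finds \<open>\<phi> = Z\<^sup>2 y g\<close> with \<open>y = c a (a\<^sup>2 - c\<^sup>2) / (4 Z\<^sup>2)\<close>,
  \<open>g\<^sup>2 = 1 - 256 y\<^sup>2\<close> and \<open>D y = y g Z\<close>. The form \<open>Z\<close> satisfies a third-order hypergeometric equation
  \<open>L Z = 0\<close> in \<open>y\<close>, and Bol's identity becomes \<open>D\<^sup>3(w / Z) = g Z\<^sup>2 L w\<close>. Hence \<open>D\<^sup>-\<^sup>3\<phi> = w / Z\<close> where
  \<open>L w = y\<close>, so \<open>w = \<Sum> v\<^sub>m y\<^sup>m\<close> with \<open>v\<^sub>m\<close> given by a two-term recurrence. Comparing the coefficients of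
  \<open>x\<^sup>p\<close> in \<open>Z \<cdot> \<Sum> a(n) n\<^sup>-\<^sup>3 x\<^sup>n = \<Sum> v\<^sub>m y\<^sup>m\<close>, everything except \<open>a(p)/p\<^sup>3\<close> and \<open>v\<^sub>p\<close> is
  \<open>p\<close>-integral, and the \<open>p\<close>-integrality of \<open>v\<^sub>p - p\<^sup>-\<^sup>2\<close> is a congruence between factorials.

  The differential equations are obtained without any theory of modular forms: the doubling
  formulas \<open>a(x) = a(x\<^sup>2) + c(x\<^sup>2)\<close>, \<open>c(x)\<^sup>2 = 4 a(x\<^sup>2) c(x\<^sup>2)\<close> force the obstruction to each equation
  to reproduce itself under \<open>x \<mapsto> x\<^sup>2\<close>, so that it vanishes as a power series. These formulas in turn
  follow from Gauss's product evaluations of \<open>\<Sum> (-1)\<^sup>n q\<^bsup>n^2\<^esup>\<close> and \<open>\<Sum> q\<^bsup>n(n+1)\<^esup>\<close>.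
\<close>

section \<open>Factorial congruences\<close>

lemma prod_lessThan_double:
  fixes f :: "nat \<Rightarrow> 'a::comm_monoid_mult"
  shows "(\<Prod>k<2*h. f k) = (\<Prod>k<h. f k * f (2*h - Suc k))"
proof -
  have "(\<Prod>k<2*h. f k) = (\<Prod>k<h. f k) * (\<Prod>k=h..<2*h. f k)"
    by (subst prod.union_disjoint[symmetric]) (auto intro!: prod.cong)
  also have "(\<Prod>k=h..<2*h. f k) = (\<Prod>k<h. f (2*h - Suc k))"
    by (rule prod.reindex_bij_witness[of _ "\<lambda>k. 2*h - Suc k" "\<lambda>k. 2*h - Suc k"]) auto
  finally show ?thesis
    by (simp add: prod.distrib)
qed

text \<open>The double factorial (2n - 1)!!.\<close>

definition odd_prod :: "nat \<Rightarrow> int" where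
  "odd_prod n = (\<Prod>i<n. 2 * int i + 1)"

lemma fact_double: "fact (2 * h) = odd_prod h * 2 ^ h * fact h"
  by (induction h) (simp_all add: odd_prod_def algebra_simps)

text \<open>(4h + 1)! splits into its odd factors (4h + 1)!! and its even factors (4h)!! = 4^h
  (2h)!.\<close>

lemma odd_prod_double_fact: "odd_prod (2 * h + 1) * 4 ^ h * fact (2 * h) = fact (4 * h + 1)"
proof (induction h)
  case (Suc h)
  have "odd_prod (2 * Suc h + 1) * 4 ^ Suc h * fact (2 * Suc h) =
     (odd_prod (2 * h + 1) * 4 ^ h * fact (2 * h)) * ((4 * int h + 3) * (4 * int h + 5) * 4 * (2 * int h + 1) * (2 * int h + 2))"
    by (simp add: odd_prod_def algebra_simps)
  also have "\<dots> = fact (4 * Suc h + 1)"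
    unfolding Suc by (simp add: algebra_simps numeral_eq_Suc)
  finally show ?case .
qed (simp add: odd_prod_def)

lemma odd_prod_add: "odd_prod (m + n) = odd_prod m * (\<Prod>l<n. 2 * int (m + l) + 1)"
  by (induction n) (simp_all add: odd_prod_def)

lemma odd_prod_reflect: "odd_prod h = (\<Prod>l<h. int (2*h+1) - 2 * (int l + 1))"
  unfolding odd_prod_def
  by (subst prod.nat_diff_reindex[symmetric]) (auto intro!: prod.cong simp: of_nat_diff)

lemma coprime_less_prime:
  assumes "prime p" "0 < k" "k < p"
  shows "coprime (int k) (int p)"
  using assms by (metis coprime_commute coprime_int_iff nat_dvd_not_less prime_imp_coprime)

context
  fixes p h :: nat
  assumes p: "prime p" and ph: "p = 2 * h + 1"
begin

text \<open>In (2p - 1)!! the factor p is the middle one; the others pair up as (p - 2j)(p + 2j)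
  with j from 1 to h.\<close>

lemma odd_prod_p: "odd_prod p = int p * (\<Prod>l<h. (int p)\<^sup>2 - 4 * (int l + 1)\<^sup>2)"
proof -
  have "odd_prod p = odd_prod (h + 1) * (\<Prod>l<h. 2 * int (h + 1 + l) + 1)"
  proof -
    have "p = h + 1 + h"
      by (simp add: ph)
    then show ?thesis
      by (simp only: odd_prod_add)
  qed
  also have "odd_prod (h + 1) = int p * (\<Prod>l<h. int p - 2 * (int l + 1))"
    using odd_prod_reflect[of h] by (simp add: odd_prod_def ph)
  also have "int p * (\<Prod>l<h. int p - 2 * (int l + 1)) * (\<Prod>l<h. 2 * int (h + 1 + l) + 1) =
      int p * (\<Prod>l<h. (int p - 2 * (int l + 1)) * (2 * int (h + 1 + l) + 1))"
    by (simp add: prod.distrib)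
  also have "(\<Prod>l<h. (int p - 2 * (int l + 1)) * (2 * int (h + 1 + l) + 1)) =
      (\<Prod>l<h. (int p)\<^sup>2 - 4 * (int l + 1)\<^sup>2)"
    by (intro prod.cong) (auto simp: ph power2_eq_square algebra_simps)
  finally show ?thesis .
qed

text \<open>Pair j with p - j: the product (p + j)(p + (p - j)) exceeds j (p - j) by exactly 2
  p^2.\<close>

lemma babbage: "[(\<Prod>k<2*h. int p + int k + 1) = fact (2 * h)] (mod (int p)\<^sup>2)"
proof -
  have "[(\<Prod>k<h. (int p + int k + 1) * (int p + int (2*h - Suc k) + 1)) =
      (\<Prod>k<h. (int k + 1) * (int (2*h - Suc k) + 1))] (mod (int p)\<^sup>2)"
  proof (rule cong_prod)
    fix k assume "k \<in> {..<h}"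
    then have "(int p + int k + 1) * (int p + int (2*h - Suc k) + 1) -
       (int k + 1) * (int (2*h - Suc k) + 1) = (int p)\<^sup>2 * 2"
      by (simp add: ph of_nat_diff power2_eq_square algebra_simps)
    then show "[(int p + int k + 1) * (int p + int (2*h - Suc k) + 1) =
       (int k + 1) * (int (2*h - Suc k) + 1)] (mod (int p)\<^sup>2)"
      by (metis cong_iff_dvd_diff dvd_triv_left)
  qed
  moreover have "fact (2 * h) = (\<Prod>k<2*h. int k + 1)"
    by (simp add: fact_prod_Suc lessThan_atLeast0 add.commute)
  ultimately show ?thesis
    by (simp add: prod_lessThan_double)
qed

lemma coprime_odd_prod: "coprime (odd_prod h) (int p)"
  unfolding odd_prod_def
proof (rule prod_coprime_left)
  fix i assume "i \<in> {..<h}"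
  then show "coprime (2 * int i + 1) (int p)"
    using coprime_less_prime[OF p, of "2 * i + 1"] by (simp add: ph add.commute)
qed

lemma coprime_fact_h: "coprime (2 ^ h * fact h) (int p)"
proof -
  have "coprime (fact (2 * h)) p"
    using p ph by (subst coprime_commute, intro prime_imp_coprime)
      (auto simp: prime_dvd_fact_iff)
  then have "coprime (fact (2 * h)) (int p)"
    by (metis coprime_int_iff of_nat_fact)
  then show ?thesis
    by (simp add: fact_double)
qed

text \<open>Comparing the two evaluations of \<open>M\<close>, from \<open>(p + j)(p - j) \<equiv> -j\<^sup>2\<close> and from
  Babbage's congruence, yields \<open>(p - 2)!! \<equiv> (-8)\<^sup>h h!\<close> modulo \<open>p\<^sup>2\<close>, a form of Morley's congruence.\<close>

lemma odd_prod_p_cong: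
  "\<exists>M. odd_prod p = int p * M \<and> [M = (-4) ^ h * (fact h)\<^sup>2] (mod (int p)\<^sup>2)
     \<and> [odd_prod h = (-8) ^ h * fact h] (mod (int p)\<^sup>2)"
proof -
  define M where "M = (\<Prod>l<h. (int p)\<^sup>2 - 4 * (int l + 1)\<^sup>2)"
  have M: "odd_prod p = int p * M"
    by (simp add: M_def odd_prod_p)
  have "[M = (\<Prod>l<h. (-4) * (int l + 1)\<^sup>2)] (mod (int p)\<^sup>2)"
    unfolding M_def by (rule cong_prod) (simp add: cong_iff_dvd_diff)
  also have "(\<Prod>l<h. (-4) * (int l + 1)\<^sup>2) = (-4) ^ h * (\<Prod>l<h. int l + 1)\<^sup>2"
    by (simp only: prod.distrib prod_constant card_lessThan prod_power_distrib)
  also have "(\<Prod>l<h. int l + 1) = fact h"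
    by (simp add: fact_prod_Suc lessThan_atLeast0 add.commute)
  finally have M_cong: "[M = (-4) ^ h * (fact h)\<^sup>2] (mod (int p)\<^sup>2)" .
  have fact_split: "fact (2 * h + 1 + n) = fact (2 * h) * (int p * (\<Prod>k<n. int p + int k + 1))" for n
    by (induction n) (simp_all add: ph algebra_simps)
  \<comment> \<open>Both sides are (4h + 1)!, split on the left at its factor p and on the right
    into odd and even factors.\<close>
  have "fact (2 * h) * (int p * (\<Prod>k<2*h. int p + int k + 1)) = int p * M * 4 ^ h * fact (2 * h)"
    using odd_prod_double_fact[of h] fact_split[of "2 * h"] M ph by simp
  then have "M * 4 ^ h = (\<Prod>k<2*h. int p + int k + 1)"
    using p by (auto simp: prime_gt_0_nat)
  then have "[M * 4 ^ h = fact (2 * h)] (mod (int p)\<^sup>2)"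
    using babbage by simp
  then have b: "[M * 4 ^ h = (2 ^ h * fact h) * odd_prod h] (mod (int p)\<^sup>2)"
    unfolding fact_double by (simp only: mult_ac)
  have "[M * 4 ^ h = (-4) ^ h * (fact h)\<^sup>2 * 4 ^ h] (mod (int p)\<^sup>2)"
    using M_cong by (rule cong_scalar_right)
  also have "(-4) ^ h * (fact h)\<^sup>2 * 4 ^ h = (2 ^ h * fact h) * ((-8) ^ h * (fact h :: int))"
    by (simp add: power2_eq_square mult_ac flip: power_mult_distrib)
  finally have "[(2 ^ h * fact h) * odd_prod h = (2 ^ h * fact h) * ((-8) ^ h * fact h)] (mod (int p)\<^sup>2)"
    by (rule cong_trans[OF cong_sym[OF b]])
  then have "[odd_prod h = (-8) ^ h * fact h] (mod (int p)\<^sup>2)"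
    using coprime_fact_h by (subst (asm) cong_mult_lcancel) auto
  then show ?thesis
    using M M_cong by blast
qed

text \<open>This is the numerator of \<open>hyp_coeff p - 1 / p ^ 2\<close> over the denominator
  \<open>p ^ 3 * odd_prod h ^ 3\<close>. Since \<open>odd_prod p\<close> contains an explicit p,
  congruences modulo p^2 suffice: they turn both cofactors of p into ((-8)^h h!)^3.\<close>

lemma odd_prod_supercongruence:
  "int p ^ 3 dvd 64 ^ h * odd_prod p * (2 ^ h * fact h) - int p * odd_prod h ^ 3"
proof -
  obtain M where M: "odd_prod p = int p * M" "[M = (-4) ^ h * (fact h)\<^sup>2] (mod (int p)\<^sup>2)"
    and Q: "[odd_prod h = (-8) ^ h * fact h] (mod (int p)\<^sup>2)"
    using odd_prod_p_cong by blast
  have "[64 ^ h * M * (2 ^ h * fact h) = 64 ^ h * ((-4) ^ h * (fact h)\<^sup>2) * (2 ^ h * fact h)] (mod (int p)\<^sup>2)"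
    using M(2) by (intro cong_mult cong_refl)
  also have "64 ^ h * ((-4) ^ h * (fact h)\<^sup>2) * (2 ^ h * fact h) = ((-8) ^ h * (fact h :: int)) ^ 3"
  proof -
    have "64 ^ h * ((-4) ^ h * (fact h)\<^sup>2) * (2 ^ h * fact h) = (64 ^ h * (-4) ^ h * 2 ^ h) * (fact h :: int) ^ 3"
      by (simp add: power2_eq_square power3_eq_cube mult_ac)
    also have "64 ^ h * (-4) ^ h * 2 ^ h = ((-8) ^ 3 :: int) ^ h"
      by (simp flip: power_mult_distrib)
    also have "\<dots> = ((-8) ^ h) ^ 3"
      by (simp only: power_mult[symmetric] mult.commute)
    finally show ?thesis
      by (simp only: power_mult_distrib)
  qed
  also have "[\<dots> = odd_prod h ^ 3] (mod (int p)\<^sup>2)"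
    using Q by (rule cong_pow[OF cong_sym])
  finally have "(int p)\<^sup>2 dvd 64 ^ h * M * (2 ^ h * fact h) - odd_prod h ^ 3"
    by (simp add: cong_iff_dvd_diff)
  then have "int p * (int p)\<^sup>2 dvd int p * (64 ^ h * M * (2 ^ h * fact h) - odd_prod h ^ 3)"
    by (rule mult_dvd_mono[OF dvd_refl])
  then show ?thesis
    by (simp add: M power3_eq_cube power2_eq_square algebra_simps)
qed

end

section \<open>Integrality at p and the coefficients of the hypergeometric solution\<close>

definition p_integral :: "nat \<Rightarrow> 'a::field_char_0 \<Rightarrow> bool" where
  "p_integral p x \<longleftrightarrow> (\<exists>d m. coprime d (int p) \<and> of_int d * x = of_int m)"

lemma p_integral_Ints:
  assumes "x \<in> \<int>"
  shows "p_integral p x"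
proof -
  obtain z where "x = of_int z"
    using assms by (elim Ints_cases)
  then show ?thesis
    unfolding p_integral_def by (intro exI[of _ 1] exI[of _ z]) simp
qed

lemma p_integral_mult:
  assumes "p_integral p x" "p_integral p y"
  shows "p_integral p (x * y)"
proof -
  obtain d m e n where "coprime d (int p)" "of_int d * x = of_int m"
    "coprime e (int p)" "of_int e * y = of_int n"
    using assms unfolding p_integral_def by blast
  then have "coprime (d * e) (int p)" "of_int (d * e) * (x * y) = of_int (m * n)"
    by (simp_all add: algebra_simps)
  then show ?thesis
    unfolding p_integral_def by blast
qed

lemma p_integral_add:
  assumes "p_integral p x" "p_integral p y"
  shows "p_integral p (x + y)"
proof -
  obtain d m e n where "coprime d (int p)" "of_int d * x = of_int m"
    "coprime e (int p)" "of_int e * y = of_int n"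
    using assms unfolding p_integral_def by blast
  then have "coprime (d * e) (int p)" "of_int (d * e) * (x + y) = of_int (m * e + n * d)"
    by (simp_all add: algebra_simps)
  then show ?thesis
    unfolding p_integral_def by blast
qed

lemma p_integral_diff:
  assumes "p_integral p x" "p_integral p y"
  shows "p_integral p (x - y)"
  using p_integral_add[OF assms(1) p_integral_mult[OF p_integral_Ints[of "-1"] assms(2)]] by simp

lemma p_integral_sum:
  assumes "\<And>i. i \<in> I \<Longrightarrow> p_integral p (f i)"
  shows "p_integral p (\<Sum>i\<in>I. f i)"
  using assms by (induction I rule: infinite_finite_induct) (auto intro: p_integral_add p_integral_Ints)

lemma p_integral_divide:
  assumes "p_integral p x" and "coprime d (int p)" and "d \<noteq> 0"
  shows "p_integral p (x / of_int d)"
proof -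
  have "p_integral p (1 / of_int d :: 'a)"
    unfolding p_integral_def using assms by (intro exI[of _ d] exI[of _ 1]) auto
  from p_integral_mult[OF assms(1) this] show ?thesis by simp
qed

text \<open>The way back from p-integrality in the field to a divisibility between integers.\<close>

lemma dvd_of_p_integral:
  assumes "p_integral p (of_int m / of_nat p ^ k :: 'a::field_char_0)" and "p > 0"
  shows "int p ^ k dvd m"
proof -
  obtain d n where d: "coprime d (int p)" and "of_int d * (of_int m / of_nat p ^ k) = (of_int n :: 'a)"
    using assms unfolding p_integral_def by blast
  then have "of_int (d * m) = (of_int (int p ^ k * n) :: 'a)"
    using \<open>p > 0\<close> by (simp add: field_simps)
  then have "int p ^ k dvd d * m"
    unfolding of_int_eq_iff by simp
  moreover have "coprime (int p ^ k) d"
    using d by (simp add: coprime_commute)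
  ultimately show ?thesis
    by (simp add: coprime_dvd_mult_right_iff)
qed

text \<open>The solution of \<open>(D\<^sup>3 - 64 Y\<^sup>2 (2D + 1)(D + 1)(2D + 3)) W = Y\<close>, with \<open>D = Y d/dY\<close>.\<close>

fun hyp_coeff :: "nat \<Rightarrow> 'a::field_char_0" where
  "hyp_coeff 0 = 0"
| "hyp_coeff (Suc 0) = 1"
| "hyp_coeff (Suc (Suc m)) = 64 * of_nat ((2 * m + 1) * (m + 1) * (2 * m + 3)) / of_nat (m + 2) ^ 3 * hyp_coeff m"

text \<open>The two-term recurrence, iterated along odd indices and cleared of denominators. The
  factor (2j + 1)^3 is kept apart from \<open>odd_prod j\<close> because at 2j + 1 = p it is the
  only part of the denominator divisible by p.\<close>

lemma hyp_coeff_odd: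
  "hyp_coeff (2 * j + 1) * of_nat (2 * j + 1) ^ 3 * of_int (odd_prod j) ^ 3 =
     (of_int (64 ^ j * odd_prod (2 * j + 1) * (2 ^ j * fact j)) :: 'a::field_char_0)"
proof (induction j)
  case (Suc j)
  have *: "of_nat (2 * j + 3) ^ 3 * hyp_coeff (2 * j + 3) =
      64 * of_nat ((4 * j + 3) * (2 * j + 2) * (4 * j + 5)) * (hyp_coeff (2 * j + 1) :: 'a)"
  proof -
    have nz: "of_nat (2 * j + 3) \<noteq> (0::'a)"
      by (metis add_is_0 of_nat_eq_0_iff zero_neq_numeral)
    have "hyp_coeff (2 * j + 3) = hyp_coeff (Suc (Suc (2 * j + 1)))"
      by (simp add: numeral_eq_Suc)
    also have "\<dots> = 64 * of_nat ((4 * j + 3) * (2 * j + 2) * (4 * j + 5)) / of_nat (2 * j + 3) ^ 3 * (hyp_coeff (2 * j + 1) :: 'a)"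
      by (subst hyp_coeff.simps) (simp add: algebra_simps)
    finally show ?thesis
      using nz by (simp del: of_nat_add of_nat_mult)
  qed
  have "hyp_coeff (2 * Suc j + 1) * of_nat (2 * Suc j + 1) ^ 3 * of_int (odd_prod (Suc j)) ^ 3 =
     64 * of_nat ((4 * j + 3) * (2 * j + 2) * (4 * j + 5)) *
       (hyp_coeff (2 * j + 1) * of_nat (2 * j + 1) ^ 3 * of_int (odd_prod j) ^ 3 :: 'a)"
  proof -
    have "2 * Suc j + 1 = 2 * j + 3"
      by simp
    moreover have "of_int (odd_prod (Suc j)) ^ 3 = (of_nat (2 * j + 1) ^ 3 * of_int (odd_prod j) ^ 3 :: 'a)"
      by (simp add: odd_prod_def power_mult_distrib add.commute mult.commute)
    ultimately show ?thesis
      using * by (simp only: mult_ac)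
  qed
  also have "\<dots> = of_int (64 ^ Suc j * odd_prod (2 * Suc j + 1) * (2 ^ Suc j * fact (Suc j)))"
    unfolding Suc by (simp add: odd_prod_def algebra_simps)
  finally show ?case .
qed (simp add: odd_prod_def)

text \<open>Below index p the recurrence divides only by cubes of positive integers less than
  p.\<close>

lemma p_integral_hyp_coeff:
  assumes "prime p" and "n < p"
  shows "p_integral p (hyp_coeff n :: 'a::field_char_0)"
  using assms(2)
proof (induction n rule: hyp_coeff.induct)
  case (3 m)
  have "coprime (int (m + 2)) (int p)"
    using 3(2) by (intro coprime_less_prime[OF assms(1)]) simp_all
  then have "p_integral p (64 * of_nat ((2 * m + 1) * (m + 1) * (2 * m + 3)) / of_int (int (m + 2) ^ 3) :: 'a)"
    by (intro p_integral_divide p_integral_Ints) auto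
  then have "p_integral p (64 * of_nat ((2 * m + 1) * (m + 1) * (2 * m + 3)) / of_nat (m + 2) ^ 3 :: 'a)"
    by (simp only: of_int_power of_int_of_nat_eq)
  then show ?case
    unfolding hyp_coeff.simps by (rule p_integral_mult) (use 3 in simp)
qed (auto intro: p_integral_Ints)

lemma p_integral_hyp_coeff_p:
  assumes "prime p" and "odd p"
  shows "p_integral p (hyp_coeff p - 1 / of_nat p ^ 2 :: 'a::field_char_0)"
proof -
  obtain h where ph: "p = 2 * h + 1"
    using \<open>odd p\<close> by (elim oddE)
  obtain N where N: "64 ^ h * odd_prod p * (2 ^ h * fact h) - int p * odd_prod h ^ 3 = int p ^ 3 * N"
    using odd_prod_supercongruence[OF assms(1) ph] by (elim dvdE)
  have p: "of_nat p \<noteq> (0::'a)"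
    using ph by (metis add_is_0 of_nat_eq_0_iff one_neq_zero)
  have "of_nat p ^ 3 * (of_int (odd_prod h ^ 3) * (hyp_coeff p - 1 / of_nat p ^ 2 :: 'a)) =
     hyp_coeff p * of_nat p ^ 3 * of_int (odd_prod h) ^ 3 - of_nat p * of_int (odd_prod h) ^ 3"
    using p by (simp add: field_simps power3_eq_cube power2_eq_square)
  also have "\<dots> = of_int (64 ^ h * odd_prod p * (2 ^ h * fact h) - int p * odd_prod h ^ 3)"
    using hyp_coeff_odd[of h, where ?'a = 'a] unfolding ph[symmetric] by simp
  also have "\<dots> = of_nat p ^ 3 * of_int N"
    unfolding N by simp
  finally have "of_int (odd_prod h ^ 3) * (hyp_coeff p - 1 / of_nat p ^ 2 :: 'a) = of_int N"
    using p by simp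
  moreover have "coprime (odd_prod h ^ 3) (int p)"
    using coprime_odd_prod[OF assms(1) ph] by simp
  ultimately show ?thesis
    unfolding p_integral_def by blast
qed

section \<open>Differential equations from the doubling formulas\<close>

definition euler_op :: "'a::comm_ring_1 fps \<Rightarrow> 'a fps" where
  "euler_op f = fps_X * fps_deriv f"

lemma euler_op_nth [simp]: "fps_nth (euler_op f) n = of_nat n * fps_nth f n"
  by (cases n) (simp_all add: euler_op_def)

lemma euler_op_add: "euler_op (f + g) = euler_op f + euler_op g"
  by (simp add: euler_op_def algebra_simps)

lemma euler_op_diff: "euler_op (f - g) = euler_op f - euler_op g"
  by (simp add: euler_op_def algebra_simps)

lemma euler_op_mult: "euler_op (f * g) = f * euler_op g + euler_op f * g"
  by (simp add: euler_op_def algebra_simps)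

lemma euler_op_power2: "euler_op (f ^ 2) = 2 * f * euler_op f"
  by (simp add: power2_eq_square euler_op_mult algebra_simps)

lemma euler_op_numeral [simp]: "euler_op (numeral k) = 0"
  by (simp add: euler_op_def)

lemma euler_op_1 [simp]: "euler_op 1 = 0"
  by (simp add: euler_op_def)

lemmas euler_op_simps = euler_op_add euler_op_diff euler_op_mult euler_op_power2

text \<open>The chain rule for Euler operators; \<open>h\<close> is the logarithmic derivative of
  the inner series. It converts an equation in the variable y into one in x.\<close>

lemma euler_op_compose:
  fixes f g h :: "'a::idom fps"
  assumes "euler_op g = g * h" and "fps_nth g 0 = 0"
  shows "euler_op (f oo g) = (euler_op f oo g) * h"
proof -
  have "euler_op (f oo g) = (fps_deriv f oo g) * euler_op g"
    by (simp add: euler_op_def fps_compose_deriv[OF assms(2)] mult_ac)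
  also have "\<dots> = (euler_op f oo g) * h"
    unfolding assms(1) unfolding euler_op_def
    by (simp add: fps_compose_mult_distrib[OF assms(2)] assms(2) mult_ac)
  finally show ?thesis .
qed

definition dilate2 :: "'a::comm_ring_1 fps \<Rightarrow> 'a fps" where
  "dilate2 f = f oo fps_X\<^sup>2"

lemma dilate2_nth: "fps_nth (dilate2 f) n = (if even n then fps_nth f (n div 2) else 0)"
  by (simp add: dilate2_def fps_nth_compose_X_power)

lemma dilate2_add: "dilate2 (f + g) = dilate2 f + dilate2 g"
  by (simp add: dilate2_def fps_compose_add_distrib)

lemma dilate2_diff: "dilate2 (f - g) = dilate2 f - dilate2 g"
  by (simp add: dilate2_def fps_compose_sub_distrib)

lemma dilate2_mult:
  fixes f g :: "'a::idom fps"
  shows "dilate2 (f * g) = dilate2 f * dilate2 g"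
  by (simp add: dilate2_def fps_compose_mult_distrib)

lemma dilate2_power2:
  fixes f :: "'a::idom fps"
  shows "dilate2 (f ^ 2) = dilate2 f ^ 2"
  by (simp add: power2_eq_square dilate2_mult)

lemmas dilate2_simps = dilate2_add dilate2_diff dilate2_mult dilate2_power2

lemma euler_op_dilate2:
  fixes f :: "'a::idom fps"
  shows "euler_op (dilate2 f) = 2 * dilate2 (euler_op f)"
  by (rule fps_ext) (auto simp: dilate2_nth numeral_fps_const elim!: evenE)

lemma dilate2_eq_0_iff: "dilate2 f = 0 \<longleftrightarrow> f = 0"
proof
  assume *: "dilate2 f = 0"
  have "fps_nth f n = fps_nth (dilate2 f) (2 * n)" for n
    by (simp add: dilate2_nth)
  then show "f = 0"
    using * by (simp add: fps_eq_iff)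
qed (simp add: dilate2_def)

lemma subdegree_dilate2:
  fixes f :: "'a::idom fps"
  shows "subdegree (dilate2 f) = 2 * subdegree f"
proof (cases "f = 0")
  case False
  then show ?thesis
    by (intro subdegreeI) (auto simp: dilate2_nth intro!: nth_less_subdegree_zero)
qed (simp add: dilate2_def)

text \<open>The constant coefficient equals four times itself, odd coefficients vanish, and each
  remaining one is four times the coefficient at half the index.\<close>

lemma self_similar_zero:
  fixes f :: "'a::field_char_0 fps"
  assumes "f = 4 * dilate2 f"
  shows "f = 0"
proof (rule fps_ext)
  fix n
  show "fps_nth f n = fps_nth 0 n"
  proof (induction n rule: less_induct)
    case (less n)
    have "fps_nth f n = fps_nth (4 * dilate2 f) n"
      using assms by simp
    also have "\<dots> = 4 * fps_nth (dilate2 f) n"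
      by (simp add: numeral_fps_const)
    finally have *: "fps_nth f n = 4 * fps_nth (dilate2 f) n" .
    show ?case
    proof (cases "n = 0")
      case True
      then show ?thesis using * by (simp add: dilate2_nth)
    next
      case False
      then show ?thesis using * less.IH[of "n div 2"] by (auto simp: dilate2_nth)
    qed
  qed
qed

text \<open>Abstracts \<open>a = \<theta>\<^sub>3\<^sup>2\<close>, \<open>c = \<theta>\<^sub>2\<^sup>2\<close>; thus \<open>c / a\<close> is the elliptic modulus \<open>k\<close>.\<close>

locale landen_pair =
  fixes a c :: "'a::field_char_0 fps"
  assumes a_landen: "a = dilate2 a + dilate2 c"
    and c_landen: "c ^ 2 = 4 * dilate2 a * dilate2 c"
    and a_0: "fps_nth a 0 = 1" and c_0: "fps_nth c 0 = 0" and c_1: "fps_nth c 1 = 4"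
begin

lemma subdegree_c: "subdegree c = 1"
  using c_1 by (intro subdegreeI) (auto simp: c_0)

lemma subdegree_unit: "subdegree (dilate2 a - dilate2 c) = 0"
  by (rule subdegreeI) (auto simp: dilate2_nth a_0 c_0)

text \<open>The obstruction \<open>U\<close> satisfies \<open>c(x) U(x) = 4 (a - c)(x\<^sup>2) U(x\<^sup>2)\<close>. Comparing orders of vanishing,
  a nonzero \<open>U\<close> would vanish to order exactly 1, which is not the case.\<close>

lemma wronskian: "a * euler_op c - c * euler_op a = c * a * (a\<^sup>2 - c\<^sup>2)"
proof -
  define U where "U = a * euler_op c - c * euler_op a - c * a * (a\<^sup>2 - c\<^sup>2)"
  define A where "A = dilate2 a"
  define C where "C = dilate2 c"
  define A' where "A' = dilate2 (euler_op a)"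
  define C' where "C' = dilate2 (euler_op c)"
  note AC = A_def[symmetric] C_def[symmetric] A'_def[symmetric] C'_def[symmetric]
  have a: "a = A + C" and c2: "c\<^sup>2 = 4 * A * C"
    unfolding A_def C_def by (rule a_landen, rule c_landen)
  have Da: "euler_op a = 2 * A' + 2 * C'"
    by (subst a_landen) (simp add: euler_op_add euler_op_dilate2 A'_def C'_def)
  \<comment> \<open>Only the square of \<open>c\<close> has a doubling formula, so its derivative is
    reached through \<open>c * euler_op c\<close>. This is why the relation for \<open>U\<close>
    carries the factor \<open>c\<close>.\<close>
  have cDc: "2 * c * euler_op c = 8 * (A' * C + A * C')"
  proof -
    have "2 * c * euler_op c = euler_op (c\<^sup>2)"
      by (simp add: euler_op_power2)
    also have "\<dots> = 8 * (A' * C + A * C')"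
      by (subst c_landen) (simp add: euler_op_simps euler_op_dilate2 A_def C_def A'_def C'_def algebra_simps)
    finally show ?thesis .
  qed
  then have cDc: "c * euler_op c = 4 * (A' * C + A * C')"
    by algebra
  have "c * U = 4 * (A - C) * (A * C' - C * A' - C * A * (A\<^sup>2 - C\<^sup>2))"
    unfolding U_def Da using a c2 cDc by algebra
  also have "A * C' - C * A' - C * A * (A\<^sup>2 - C\<^sup>2) = dilate2 U"
    by (simp add: U_def dilate2_simps AC)
  finally have cU: "c * U = 4 * (A - C) * dilate2 U" .
  have U1: "fps_nth U 0 = 0" "fps_nth U 1 = 0"
    by (simp_all add: U_def a_0 c_0 c_1 fps_mult_nth_1 power2_eq_square)
  have "U = 0"
  proof (rule ccontr)
    assume "U \<noteq> 0"
    have "fps_nth (A - C) 0 = 1"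
      by (simp add: A_def C_def dilate2_nth a_0 c_0)
    then have nz: "c \<noteq> 0" "A - C \<noteq> 0" "dilate2 U \<noteq> 0"
      using c_1 \<open>U \<noteq> 0\<close> by (auto simp: dilate2_eq_0_iff)
    have "subdegree (c * U) = 1 + subdegree U"
      using nz \<open>U \<noteq> 0\<close> by (simp add: subdegree_c)
    moreover have "subdegree (4 * (A - C) * dilate2 U) = 2 * subdegree U"
      using nz subdegree_unit
      by (simp add: subdegree_dilate2 A_def C_def numeral_fps_const)
    ultimately have "subdegree U = 1"
      using cU by simp
    then show False
      using U1 \<open>U \<noteq> 0\<close> nth_subdegree_nonzero[of U] by simp
  qed
  then show ?thesis
    by (simp add: U_def)
qed

text \<open>The logarithmic derivative of \<open>a\<close>. With \<open>a\<close> and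
  \<open>c\<close> it generates a ring closed under \<open>euler_op\<close>, an analogue of
  Ramanujan's system for the Eisenstein series of weights 2, 4 and 6.\<close>

definition P :: "'a fps" where "P = euler_op a * inverse a"

lemma a_nz: "a \<noteq> 0"
  using a_0 by auto

lemma euler_a: "euler_op a = a * P"
  using inverse_mult_eq_1[of a] a_0 by (simp add: P_def mult_ac)

lemma euler_c: "euler_op c = c * (P + a\<^sup>2 - c\<^sup>2)"
proof -
  have "a * euler_op c = a * (c * (P + a\<^sup>2 - c\<^sup>2))"
    using wronskian euler_a by algebra
  then show ?thesis
    using a_nz by simp
qed

text \<open>The doubling formula for \<open>P\<close> follows from those for \<open>a\<close> and
  \<open>c\<close>. The obstruction \<open>V\<close> then satisfies V(x) = 4 V(x^2) with no further
  cofactor, so \<open>self_similar_zero\<close> applies directly.\<close>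

lemma euler_P: "euler_op P = P\<^sup>2 + c\<^sup>2 * (a\<^sup>2 - c\<^sup>2)"
proof -
  define V where "V = euler_op P - P\<^sup>2 - c\<^sup>2 * (a\<^sup>2 - c\<^sup>2)"
  define A where "A = dilate2 a"
  define C where "C = dilate2 c"
  define R where "R = dilate2 P"
  define E where "E = dilate2 (euler_op P)"
  note AC = A_def[symmetric] C_def[symmetric] R_def[symmetric] E_def[symmetric]
  have a: "a = A + C" and c2: "c\<^sup>2 = 4 * A * C"
    unfolding A_def C_def by (rule a_landen, rule c_landen)
  have DA: "euler_op A = 2 * A * R" and DC: "euler_op C = 2 * C * (R + A\<^sup>2 - C\<^sup>2)"
    by (simp_all add: A_def C_def R_def euler_op_dilate2 euler_a euler_c dilate2_simps)
  have "a * P = euler_op A + euler_op C"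
    unfolding euler_a[symmetric] by (subst a) (simp add: euler_op_add)
  also have "\<dots> = a * (2 * R + 2 * C * (A - C))"
    unfolding DA DC a by algebra
  finally have P: "P = 2 * R + 2 * C * (A - C)"
    using a_nz by simp
  have DP: "euler_op P = 4 * E + 4 * C * (R + A\<^sup>2 - C\<^sup>2) * (A - C)
     + 4 * C * (A * R - C * (R + A\<^sup>2 - C\<^sup>2))"
    by (subst P) (simp add: euler_op_simps DA DC R_def E_def euler_op_dilate2 algebra_simps)
  have "V = 4 * (E - R\<^sup>2 - C\<^sup>2 * (A\<^sup>2 - C\<^sup>2))"
    unfolding V_def DP using P a c2 by algebra
  also have "\<dots> = 4 * dilate2 V"
    by (simp add: V_def dilate2_simps AC)
  finally have "V = 0"
    by (rule self_similar_zero)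
  then show ?thesis
    by (simp add: V_def algebra_simps)
qed

section \<open>The hypergeometric parametrization\<close>

definition Z :: "'a fps" where "Z = a\<^sup>2 + c\<^sup>2"
text \<open>The factor 1/4 normalizes the leading term to x, because \<open>c\<close> starts with 4
  x.\<close>

definition y :: "'a fps" where "y = fps_const (1/4) * c * a * (a\<^sup>2 - c\<^sup>2) * inverse Z ^ 2"
text \<open>The square root of 1 - 256 y^2 with constant coefficient 1, written rationally in
  \<open>a\<close> and \<open>c\<close>.\<close>

definition g :: "'a fps" where "g = (a^4 - 6 * a\<^sup>2 * c\<^sup>2 + c^4) * inverse Z ^ 2"

lemma Z_0: "fps_nth Z 0 = 1"
  by (simp add: Z_def a_0 c_0 power2_eq_square)

lemma Z_inverse: "Z * inverse Z = 1"
  using inverse_mult_eq_1[of Z] Z_0 by (simp add: mult_ac)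

lemma Z_nz: "Z \<noteq> 0"
  using Z_0 by auto

lemma four_y: "4 * y * Z\<^sup>2 = c * a * (a\<^sup>2 - c\<^sup>2)"
proof -
  have "4 * fps_const (1/4) = (1 :: 'a fps)"
    by (simp add: numeral_fps_const)
  then show ?thesis
    unfolding y_def using Z_inverse by algebra
qed

lemma g_Z: "g * Z\<^sup>2 = a^4 - 6 * a\<^sup>2 * c\<^sup>2 + c^4"
  unfolding g_def using Z_inverse by algebra

lemma y_0: "fps_nth y 0 = 0"
  by (simp add: y_def c_0)

lemma euler_Z: "euler_op Z = 2 * a\<^sup>2 * P + 2 * c\<^sup>2 * (P + a\<^sup>2 - c\<^sup>2)"
  unfolding Z_def by (simp add: euler_op_simps euler_a euler_c power2_eq_square algebra_simps)

text \<open>\<open>y\<close> is a quotient of forms of equal weight, so \<open>P\<close> cancels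
  from its derivative. What remains is a polynomial identity in \<open>a\<close> and
  \<open>c\<close> once multiplied by Z^3.\<close>

lemma euler_y: "euler_op y = y * (g * Z)"
proof -
  have "4 * (Z\<^sup>2 * euler_op y + y * (2 * Z * euler_op Z)) = euler_op (4 * y * Z\<^sup>2)"
    by (simp add: euler_op_simps algebra_simps)
  also have "\<dots> = euler_op (c * a * (a\<^sup>2 - c\<^sup>2))"
    by (simp add: four_y)
  also have "\<dots> = c * a * (2 * a * (a * P) - 2 * c * (c * (P + a\<^sup>2 - c\<^sup>2)))
     + (c * (a * P) + c * (P + a\<^sup>2 - c\<^sup>2) * a) * (a\<^sup>2 - c\<^sup>2)"
    by (simp add: euler_op_simps euler_a euler_c)
  finally have "Z ^ 3 * (4 * euler_op y) = Z ^ 3 * (4 * (y * (g * Z)))"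
    unfolding euler_Z using four_y g_Z Z_def by algebra
  then show ?thesis
    using Z_nz by simp
qed

text \<open>\<open>g * Z\<^sup>2\<close> and 16 y Z^2 are formally the real and imaginary parts of
  (a + i c)^4, whose norm is (a^2 + c^2)^4 = Z^4.\<close>

lemma g_squared: "g\<^sup>2 = 1 - 256 * y\<^sup>2"
proof -
  have "Z ^ 4 * g\<^sup>2 = Z ^ 4 * (1 - 256 * y\<^sup>2)"
    using four_y g_Z Z_def by algebra
  then show ?thesis
    using Z_nz by simp
qed

lemma g_nz: "g \<noteq> 0"
proof -
  have "fps_nth (g * Z\<^sup>2) 0 = 1"
    unfolding g_Z by (simp add: a_0 c_0 fps_power_zeroth)
  then show ?thesis by auto
qed

lemma euler_g: "euler_op g = - 256 * y\<^sup>2 * Z"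
proof -
  have "2 * g * euler_op g = euler_op (1 - 256 * y\<^sup>2)"
    by (simp flip: g_squared add: euler_op_power2)
  also have "\<dots> = 2 * g * (- 256 * y\<^sup>2 * Z)"
    by (simp add: euler_op_simps euler_y power2_eq_square algebra_simps)
  finally show ?thesis
    by (rule mult_left_cancel[THEN iffD1, rotated]) (use g_nz in simp)
qed

text \<open>The logarithmic derivative of \<open>Z\<close>, not the differential operator called L
  in the opening comment.\<close>

definition L :: "'a fps" where "L = euler_op Z * inverse Z"

lemma euler_Z_L: "euler_op Z = L * Z"
  using Z_inverse by (simp add: L_def mult_ac)

text \<open>The Riccati form of the hypergeometric equation for \<open>Z\<close>.\<close>

lemma euler_L: "2 * euler_op L = L\<^sup>2 + 192 * y\<^sup>2 * Z\<^sup>2"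
proof -
  have DD: "euler_op (euler_op Z) = euler_op L * Z + L * (L * Z)"
    by (subst euler_Z_L) (simp add: euler_op_mult euler_Z_L)
  have DDZ: "euler_op (euler_op Z) = 2 * a\<^sup>2 * (P\<^sup>2 + c\<^sup>2 * (a\<^sup>2 - c\<^sup>2)) + 2 * (2 * a * (a * P)) * P
    + 2 * (2 * c * (c * (P + a\<^sup>2 - c\<^sup>2))) * (P + a\<^sup>2 - c\<^sup>2)
    + 2 * c\<^sup>2 * (P\<^sup>2 + c\<^sup>2 * (a\<^sup>2 - c\<^sup>2) + 2 * a * (a * P) - 2 * c * (c * (P + a\<^sup>2 - c\<^sup>2)))"
    unfolding euler_Z by (simp add: euler_op_simps euler_P euler_a euler_c)
  \<comment> \<open>Up to a scalar this is the second Rankin-Cohen bracket of the weight 2 form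
    \<open>Z\<close> with itself, hence \<open>P\<close> cancels. The right side is 192 y^2 Z^4 by
    \<open>four_y\<close>.\<close>
  have "2 * Z * euler_op (euler_op Z) - 3 * euler_op Z * euler_op Z = 12 * a\<^sup>2 * c\<^sup>2 * (a\<^sup>2 - c\<^sup>2)\<^sup>2"
    unfolding DDZ unfolding euler_Z unfolding Z_def by algebra
  then have "2 * Z * (euler_op L * Z + L * (L * Z)) - 3 * (L * Z) * (L * Z) = 192 * y\<^sup>2 * Z^4"
    unfolding DD unfolding euler_Z_L using four_y by algebra
  then have "Z\<^sup>2 * (2 * euler_op L) = Z\<^sup>2 * (L\<^sup>2 + 192 * y\<^sup>2 * Z\<^sup>2)"
    by algebra
  then show ?thesis
    using Z_nz by simp
qed

text \<open>Bol's identity: three derivatives take weight -2 to weight 4, so \<open>L\<close> drops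
  out by the Riccati equation. What is left is the hypergeometric operator applied to
  \<open>W\<close>, evaluated at \<open>y\<close>, and the hypothesis on \<open>W\<close> reduces it
  to \<open>y\<close>.\<close>

lemma euler_op_cube_compose:
  fixes W :: "'a fps"
  assumes W: "euler_op (euler_op (euler_op W)) = fps_X + 64 * fps_X\<^sup>2 *
    (4 * euler_op (euler_op (euler_op W)) + 12 * euler_op (euler_op W) + 11 * euler_op W + 3 * W)"
  shows "euler_op (euler_op (euler_op ((W oo y) * inverse Z))) = g * Z\<^sup>2 * y"
proof -
  define w0 w1 w2 w3 where "w0 = W oo y" and "w1 = euler_op W oo y"
    and "w2 = euler_op (euler_op W) oo y" and "w3 = euler_op (euler_op (euler_op W)) oo y"
  have Dw: "euler_op w0 = w1 * (g * Z)" "euler_op w1 = w2 * (g * Z)" "euler_op w2 = w3 * (g * Z)"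
    unfolding w0_def w1_def w2_def w3_def
    by (rule euler_op_compose[OF euler_y y_0])+
  have num: "numeral k oo y = numeral k" for k
    by (simp add: numeral_fps_const)
  have w3: "w3 = y + 64 * y\<^sup>2 * (4 * w3 + 12 * w2 + 11 * w1 + 3 * w0)"
    unfolding w3_def by (subst W)
      (simp add: w0_def w1_def w2_def w3_def fps_compose_mult_distrib[OF y_0] num
        fps_compose_add_distrib power2_eq_square fps_X_fps_compose_startby0[OF y_0])
  define s where "s = inverse Z"
  have Zs: "Z * s = 1"
    by (simp add: s_def Z_inverse)
  have Ds: "euler_op s = - L * s"
  proof -
    have "Z * euler_op s + euler_op Z * s = euler_op (Z * s)"
      by (simp add: euler_op_mult)
    then have "Z * euler_op s + (L * Z) * s = 0"
      by (simp add: Zs flip: euler_Z_L)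
    then have "Z * euler_op s = Z * (- L * s)"
      by algebra
    then show ?thesis
      by (rule mult_left_cancel[OF Z_nz, THEN iffD1])
  qed
  have D1: "euler_op (w0 * s) = g * w1 - L * s * w0"
    unfolding euler_op_mult Ds Dw using Zs by algebra
  \<comment> \<open>The factor 2 produces \<open>2 * euler_op L\<close>, which
    \<open>euler_L\<close> replaces without a division.\<close>
  have "2 * euler_op (euler_op (w0 * s)) =
      2 * (w1 * (-256 * y\<^sup>2 * Z) + g * (w2 * (g * Z)))
      - 2 * L * s * (w1 * (g * Z)) - 2 * L * (- L * s) * w0 - (2 * euler_op L) * s * w0"
    unfolding D1 by (simp add: euler_op_simps Dw Ds euler_g algebra_simps)
  then have D2: "2 * euler_op (euler_op (w0 * s)) = 2 * Z * g\<^sup>2 * w2 - 512 * y\<^sup>2 * Z * w1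
      - 2 * L * g * w1 + L\<^sup>2 * s * w0 - 192 * y\<^sup>2 * Z * w0"
    unfolding euler_L using Zs by algebra
  have "2 * (2 * euler_op (euler_op (euler_op (w0 * s)))) = 2 * euler_op (2 * euler_op (euler_op (w0 * s)))"
    by (simp add: euler_op_mult)
  also have "\<dots> = 4 * (L * Z) * g\<^sup>2 * w2 + 8 * Z * g * (-256 * y\<^sup>2 * Z) * w2 + 4 * Z * g\<^sup>2 * (w3 * (g * Z))
     - 1024 * (2 * y * (y * (g * Z)) * Z * w1 + y\<^sup>2 * (L * Z) * w1 + y\<^sup>2 * Z * (w2 * (g * Z)))
     - 2 * (2 * euler_op L) * g * w1 - 4 * L * (-256 * y\<^sup>2 * Z) * w1 - 4 * L * g * (w2 * (g * Z))
     + 2 * L * (2 * euler_op L) * s * w0 + 2 * L\<^sup>2 * (- L * s) * w0 + 2 * L\<^sup>2 * s * (w1 * (g * Z))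
     - 384 * (2 * y * (y * (g * Z)) * Z * w0 + y\<^sup>2 * (L * Z) * w0 + y\<^sup>2 * Z * (w1 * (g * Z)))"
    unfolding D2
    by (simp add: euler_op_simps Dw Ds euler_g euler_y euler_Z_L algebra_simps)
  \<comment> \<open>Every term containing \<open>L\<close> has cancelled.\<close>
  finally have "4 * euler_op (euler_op (euler_op (w0 * s))) =
      4 * g * Z\<^sup>2 * (g\<^sup>2 * w3 - 64 * y\<^sup>2 * (12 * w2 + 11 * w1 + 3 * w0))"
    unfolding euler_L using Zs by algebra
  also have "\<dots> = 4 * (g * Z\<^sup>2 * y)"
    unfolding g_squared using w3 by algebra
  finally show ?thesis
    by (simp add: w0_def s_def)
qed

end

section \<open>Series with integer coefficients and the comparison at x^p\<close>

definition int_coeffs :: "'a::ring_1 fps \<Rightarrow> bool" where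
  "int_coeffs f \<longleftrightarrow> (\<forall>n. fps_nth f n \<in> \<int>)"

lemma int_coeffs_add: "int_coeffs f \<Longrightarrow> int_coeffs g \<Longrightarrow> int_coeffs (f + g)"
  by (simp add: int_coeffs_def)

lemma int_coeffs_diff: "int_coeffs f \<Longrightarrow> int_coeffs g \<Longrightarrow> int_coeffs (f - g)"
  by (simp add: int_coeffs_def)

lemma int_coeffs_mult: "int_coeffs f \<Longrightarrow> int_coeffs g \<Longrightarrow> int_coeffs (f * g)"
  by (auto simp: int_coeffs_def fps_mult_nth intro: Ints_sum Ints_mult)

lemma int_coeffs_1: "int_coeffs 1"
  by (simp add: int_coeffs_def)

lemma int_coeffs_power: "int_coeffs f \<Longrightarrow> int_coeffs (f ^ n)"
  by (induction n) (auto intro: int_coeffs_mult int_coeffs_1)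

lemma int_coeffs_numeral: "int_coeffs (numeral k)"
  by (simp add: int_coeffs_def numeral_fps_const)

lemma int_coeffs_dilate2: "int_coeffs f \<Longrightarrow> int_coeffs (dilate2 f)"
  by (simp add: int_coeffs_def dilate2_nth)

lemma int_coeffs_inverse:
  fixes f :: "'a::field fps"
  assumes "int_coeffs f" "fps_nth f 0 = 1"
  shows "int_coeffs (inverse f)"
proof -
  have "fps_nth (inverse f) n \<in> \<int>" for n
  proof (induction n rule: less_induct)
    case (less n)
    show ?case
    proof (cases "n = 0")
      case False
      have "(\<Sum>i=0..n. fps_nth f i * fps_nth (inverse f) (n - i)) = 0"
        using inverse_mult_eq_1'[of f] assms(2) False fps_mult_nth[of f "inverse f" n] by simp
      then have "fps_nth (inverse f) n = - (\<Sum>i=1..n. fps_nth f i * fps_nth (inverse f) (n - i))"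
        using assms(2) by (simp add: sum.atLeast_Suc_atMost eq_neg_iff_add_eq_0)
      also have "\<dots> \<in> \<int>"
        using assms(1) less.IH by (intro Ints_minus Ints_sum Ints_mult) (auto simp: int_coeffs_def)
      finally show ?thesis .
    qed (simp add: assms(2))
  qed
  then show ?thesis
    by (simp add: int_coeffs_def)
qed

definition hyp_series :: "'a::field_char_0 fps" where
  "hyp_series = Abs_fps hyp_coeff"

text \<open>Coefficientwise this is the recurrence, because 4m^3 + 12m^2 + 11m + 3 = (2m + 1)(m +
  1)(2m + 3).\<close>

lemma hyp_series_equation:
  fixes W :: "'a::field_char_0 fps"
  defines "W \<equiv> hyp_series"
  shows "euler_op (euler_op (euler_op W)) = fps_X + 64 * fps_X\<^sup>2 *
    (4 * euler_op (euler_op (euler_op W)) + 12 * euler_op (euler_op W) + 11 * euler_op W + 3 * W)"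
proof (rule fps_ext)
  fix n :: nat
  consider "n = 0" | "n = 1" | m where "n = Suc (Suc m)"
    by (metis One_nat_def not0_implies_Suc)
  then show "fps_nth (euler_op (euler_op (euler_op W))) n = fps_nth (fps_X + 64 * fps_X\<^sup>2 *
    (4 * euler_op (euler_op (euler_op W)) + 12 * euler_op (euler_op W) + 11 * euler_op W + 3 * W)) n"
  proof cases
    case (3 m)
    have shift: "fps_nth (fps_X + 64 * fps_X\<^sup>2 * G) n = 64 * fps_nth G m" for G :: "'a fps"
      by (simp add: 3 mult.assoc fps_X_power_mult_nth)
    have nz: "of_nat (m + 2) \<noteq> (0::'a)"
      by (metis add_is_0 of_nat_eq_0_iff zero_neq_numeral)
    have "fps_nth (euler_op (euler_op (euler_op W))) n = of_nat (m + 2) ^ 3 * hyp_coeff (Suc (Suc m))"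
      by (simp add: 3 W_def hyp_series_def power3_eq_cube mult.assoc)
    also have "\<dots> = 64 * of_nat ((2 * m + 1) * (m + 1) * (2 * m + 3)) * hyp_coeff m"
      unfolding hyp_coeff.simps using nz by (simp del: of_nat_add of_nat_mult)
    also have "\<dots> = fps_nth (fps_X + 64 * fps_X\<^sup>2 *
    (4 * euler_op (euler_op (euler_op W)) + 12 * euler_op (euler_op W) + 11 * euler_op W + 3 * W)) n"
      unfolding shift by (simp add: W_def hyp_series_def) (simp add: algebra_simps)
    finally show ?thesis .
  qed (simp_all add: W_def hyp_series_def mult.assoc fps_X_power_mult_nth)
qed

text \<open>The series \<open>d\<close> absorbs the 1/4 in the definition of \<open>y\<close>, which
  makes \<open>y\<close> integral. The congruence comes from the coefficient of x^p in
  \<open>F * Z = hyp_series oo y\<close>, where \<open>F\<close> is a threefold antiderivative under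
  \<open>euler_op\<close>.\<close>

lemma (in landen_pair) coeff_cong_of_landen_pair:
  fixes d :: "'a fps" and \<alpha> :: "nat \<Rightarrow> int"
  assumes int: "int_coeffs a" "int_coeffs d" and c: "c = 4 * d"
    and \<alpha>: "\<And>n. of_int (\<alpha> n) = fps_nth (g * Z\<^sup>2 * y) n"
    and p: "prime p" "odd p"
  shows "int p ^ 3 dvd \<alpha> p - int p"
proof -
  have int_c: "int_coeffs c"
    by (subst c) (intro int_coeffs_mult int int_coeffs_numeral)
  have int_Z: "int_coeffs Z"
    unfolding Z_def by (intro int_coeffs_add int_coeffs_power int int_c)
  have "fps_const (1/4) * c = d"
    by (simp add: c numeral_fps_const fps_eq_iff)
  then have y: "y = d * a * (a\<^sup>2 - c\<^sup>2) * inverse Z ^ 2"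
    by (simp add: y_def)
  have int_y: "int_coeffs y"
    unfolding y
    by (intro int_coeffs_mult int_coeffs_diff int_coeffs_power int int_c int_coeffs_inverse int_Z Z_0)
  have y1: "fps_nth y 1 = 1"
  proof -
    have "fps_nth d 0 = 0" "fps_nth d 1 = 1"
      using c_0 c_1 by (simp_all add: c)
    then show ?thesis
      by (simp add: y fps_mult_nth_1 fps_power_zeroth a_0 c_0 Z_0)
  qed
  define F where "F = (hyp_series oo y) * inverse Z"
  have F_nth: "of_nat n ^ 3 * fps_nth F n = of_int (\<alpha> n)" for n
    using arg_cong[OF euler_op_cube_compose[OF hyp_series_equation], of "\<lambda>f. fps_nth f n"]
    by (simp add: \<alpha> F_def power3_eq_cube mult.assoc)
  \<comment> \<open>The preceding relation is vacuous for the left side at n = 0, so this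
    coefficient is computed separately.\<close>
  have F0: "fps_nth F 0 = 0"
    by (simp add: F_def hyp_series_def)
  have FZ: "F * Z = hyp_series oo y"
    using Z_inverse by (simp add: F_def mult_ac)
  have p_pos: "p > 0"
    using p by (simp add: prime_gt_0_nat)
  have F_int: "p_integral p (fps_nth F n)" if "n < p" for n
  proof (cases "n = 0")
    case False
    have "coprime (int n) (int p)"
      using p that False by (intro coprime_less_prime) simp_all
    then have "p_integral p (of_int (\<alpha> n) / of_int (int n ^ 3) :: 'a)"
      using False by (intro p_integral_divide p_integral_Ints) auto
    also have "of_int (\<alpha> n) / of_int (int n ^ 3) = fps_nth F n"
      using False F_nth[of n, symmetric] by simp
    finally show ?thesis .
  qed (simp add: F0 p_integral_Ints)
  \<comment> \<open>\<open>Z\<close> has constant coefficient 1 and \<open>y ^ p\<close> has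
    coefficient 1 at x^p, so the terms with index p are exactly \<open>fps_nth F p\<close> and
    \<open>hyp_coeff p\<close>.\<close>
  have "(\<Sum>i<p. fps_nth F i * fps_nth Z (p - i)) + fps_nth F p = fps_nth (F * Z) p"
    by (simp add: fps_mult_nth Z_0 atLeast0AtMost lessThan_Suc_atMost[symmetric])
  also have "\<dots> = (\<Sum>i<p. hyp_coeff i * fps_nth (y ^ i) p) + hyp_coeff p"
    using startsby_zero_power_nth_same[OF y_0, of p] y1
    by (simp add: FZ fps_compose_nth hyp_series_def atLeast0AtMost lessThan_Suc_atMost[symmetric])
  finally have "fps_nth F p - 1 / of_nat p ^ 2 =
     (\<Sum>i<p. hyp_coeff i * fps_nth (y ^ i) p) - (\<Sum>i<p. fps_nth F i * fps_nth Z (p - i)) +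
     (hyp_coeff p - 1 / of_nat p ^ 2)"
    by (simp add: algebra_simps)
  moreover have "p_integral p \<dots>"
    using int_y[THEN int_coeffs_power] int_Z p
    by (intro p_integral_add p_integral_diff p_integral_sum p_integral_mult F_int
         p_integral_hyp_coeff p_integral_hyp_coeff_p p_integral_Ints) (auto simp: int_coeffs_def)
  ultimately have "p_integral p (fps_nth F p - 1 / of_nat p ^ 2)"
    by (simp only:)
  also have "fps_nth F p - 1 / of_nat p ^ 2 = of_int (\<alpha> p - int p) / of_nat p ^ 3"
    using p_pos F_nth[of p, symmetric] by (simp add: field_simps power3_eq_cube power2_eq_square)
  finally show ?thesis
    using p_pos by (rule dvd_of_p_integral)
qed

section \<open>Gauss's theta products\<close>

definition euler_prod :: "complex \<Rightarrow> complex" where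
  "euler_prod q = (\<Prod>n. 1 - q ^ Suc n)"

definition euler_part :: "nat \<Rightarrow> complex \<Rightarrow> complex" where
  "euler_part N q = (\<Prod>n<N. 1 - q ^ Suc n)"

lemma one_minus_power_nz:
  fixes q :: complex
  assumes "norm q < 1" "n > 0"
  shows "1 - q ^ n \<noteq> 0"
proof
  assume "1 - q ^ n = 0"
  then have "norm q ^ n = 1"
    by (metis eq_iff_diff_eq_0 norm_one norm_power)
  moreover have "norm q ^ n < 1"
    using assms by (simp add: power_less_one_iff)
  ultimately show False by simp
qed

lemma convergent_euler_prod:
  assumes "norm q < 1"
  shows "convergent_prod (\<lambda>n. 1 - q ^ Suc n :: complex)"
proof -
  have "summable (\<lambda>n. norm (- (q ^ Suc n)))"
    using assms by (simp add: norm_mult norm_power summable_mult)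
  moreover have "- (q ^ Suc n) \<noteq> -1" for n
    using one_minus_power_nz[OF assms, of "Suc n"] by auto
  ultimately show ?thesis
    using summable_imp_convergent_prod_complex[of "\<lambda>n. - (q ^ Suc n)"] by simp
qed

lemma euler_part_tendsto:
  assumes "norm q < 1"
  shows "(\<lambda>N. euler_part N q) \<longlonglongrightarrow> euler_prod q"
  using convergent_prod_LIMSEQ[OF convergent_euler_prod[OF assms]]
  by (simp add: LIMSEQ_lessThan_iff_atMost euler_part_def euler_prod_def)

lemma euler_prod_nz:
  assumes "norm q < 1"
  shows "euler_prod q \<noteq> 0"
  unfolding euler_prod_def
  by (rule prodinf_nonzero[OF convergent_euler_prod[OF assms]]) (rule one_minus_power_nz[OF assms], simp)

lemma euler_part_nz:
  assumes "norm q < 1"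
  shows "euler_part N q \<noteq> 0"
  using one_minus_power_nz[OF assms] by (simp add: euler_part_def del: power_Suc)

lemma norm_power_less_1: "norm q < 1 \<Longrightarrow> n > 0 \<Longrightarrow> norm (q ^ n :: complex) < 1"
  by (simp add: norm_power power_less_one_iff)

lemma euler_part_Suc: "euler_part (Suc n) q = euler_part n q * (1 - q ^ Suc n)"
  by (simp add: euler_part_def)

lemma euler_part_0 [simp]: "euler_part 0 q = 1"
  by (simp add: euler_part_def)

text \<open>For even n the factors of q and -q agree, and for odd n they multiply to 1 - q^(2n). The
  product over q^4 supplies the even n missing there. Two factors are added per induction
  step.\<close>

lemma euler_prod_minus:
  assumes "norm q < 1"
  shows "euler_prod q * euler_prod (-q) * euler_prod (q ^ 4) = euler_prod (q\<^sup>2) ^ 3"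
proof -
  have "euler_part (2*N) q * euler_part (2*N) (-q) * euler_part N (q^4) =
      euler_part N (q\<^sup>2) ^ 2 * euler_part (2*N) (q\<^sup>2)" for N
  proof (induction N)
    case (Suc N)
    have 1: "2 * Suc N = Suc (Suc (2 * N))" by simp
    define u where "u = q ^ (2 * N)"
    have "(-q) ^ (2*N) = u"
      by (simp add: u_def power_mult)
    then have u_minus: "(-q) ^ Suc (2*N) = - (u * q)" "(-q) ^ Suc (Suc (2*N)) = u * q\<^sup>2"
      by (simp_all add: power2_eq_square)
    have u: "q ^ Suc (2*N) = u * q" "q ^ Suc (Suc (2*N)) = u * q\<^sup>2"
      "(q^4) ^ Suc N = (u * q\<^sup>2)\<^sup>2" "(q\<^sup>2) ^ Suc N = u * q\<^sup>2"
      "(q\<^sup>2) ^ Suc (2 * N) = (u * q)\<^sup>2" "(q\<^sup>2) ^ Suc (Suc (2 * N)) = (u * q\<^sup>2)\<^sup>2"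
      by (simp_all add: u_def power_mult_distrib power_add eval_nat_numeral flip: power_mult)
    show ?case
      unfolding 1 euler_part_Suc u u_minus using Suc by algebra
  qed simp
  moreover have "(\<lambda>N. euler_part (2*N) q * euler_part (2*N) (-q) * euler_part N (q^4))
      \<longlonglongrightarrow> euler_prod q * euler_prod (-q) * euler_prod (q^4)"
    and "(\<lambda>N. euler_part N (q\<^sup>2) ^ 2 * euler_part (2*N) (q\<^sup>2)) \<longlonglongrightarrow> euler_prod (q\<^sup>2) ^ 2 * euler_prod (q\<^sup>2)"
    using assms
    by (intro tendsto_intros euler_part_tendsto norm_power_less_1
         filterlim_compose[OF euler_part_tendsto mult_nat_left_at_top]; simp)+
  ultimately show ?thesis
    by (simp add: LIMSEQ_unique power2_eq_square power3_eq_cube)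
qed

text \<open>The bound is geometric in both indices, so the terms with s \<ge> 1 sum to O(r^n)
  however many there are.\<close>

lemma shanks_limit:
  fixes P :: "nat \<Rightarrow> complex"
  assumes "P \<longlonglongrightarrow> L" and r: "0 \<le> r" "r < 1"
    and S: "\<And>n. S n = P n + (\<Sum>s\<in>{1..m n}. t n s)"
    and t: "\<And>n s. s \<ge> 1 \<Longrightarrow> s \<le> m n \<Longrightarrow> norm (t n s) \<le> C * r ^ (n + s)"
  shows "S \<longlonglongrightarrow> L"
proof -
  have C: "norm (\<Sum>s\<in>{1..m n}. t n s) \<le> \<bar>C\<bar> * r ^ n * (1 / (1 - r))" for n
  proof -
    have "norm (\<Sum>s\<in>{1..m n}. t n s) \<le> (\<Sum>s\<in>{1..m n}. \<bar>C\<bar> * r ^ n * r ^ s)"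
    proof (rule sum_norm_le)
      fix s assume "s \<in> {1..m n}"
      then have "norm (t n s) \<le> C * r ^ (n + s)"
        using t by auto
      also have "\<dots> \<le> \<bar>C\<bar> * r ^ (n + s)"
        using r by (intro mult_right_mono) auto
      finally show "norm (t n s) \<le> \<bar>C\<bar> * r ^ n * r ^ s"
        by (simp add: power_add mult.assoc)
    qed
    also have "\<dots> = \<bar>C\<bar> * r ^ n * (\<Sum>s\<in>{1..m n}. r ^ s)"
      by (simp add: sum_distrib_left)
    also have "(\<Sum>s\<in>{1..m n}. r ^ s) \<le> (\<Sum>s. r ^ s)"
      using r by (intro sum_le_suminf) auto
    also have "(\<Sum>s. r ^ s) = 1 / (1 - r)"
      using r by (intro suminf_geometric) auto
    finally show ?thesis
      using r by (simp add: mult_left_mono)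
  qed
  have "(\<lambda>n. \<bar>C\<bar> * r ^ n * (1 / (1 - r))) \<longlonglongrightarrow> \<bar>C\<bar> * 0 * (1 / (1 - r))"
    using r by (intro tendsto_intros LIMSEQ_power_zero) auto
  then have "(\<lambda>n. \<Sum>s\<in>{1..m n}. t n s) \<longlonglongrightarrow> 0"
    by (intro Lim_null_comparison[OF always_eventually[OF allI[OF C]]]) simp
  from tendsto_add[OF assms(1) this] show ?thesis
    unfolding S[symmetric] by simp
qed

lemma bounded_ratio:
  fixes P :: "nat \<Rightarrow> complex"
  assumes "P \<longlonglongrightarrow> L" "L \<noteq> 0"
  obtains C where "C > 0" "\<And>n s. norm (P n / P s) \<le> C"
proof -
  have "Bseq P" "Bseq (\<lambda>n. inverse (P n))"
    using assms by (auto intro!: convergent_imp_Bseq convergentI tendsto_inverse)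
  then obtain A B where "A > 0" "\<And>n. norm (P n) \<le> A" "B > 0" "\<And>n. norm (inverse (P n)) \<le> B"
    unfolding Bseq_def by auto
  then have "norm (P n / P s) \<le> A * B" for n s
    unfolding divide_inverse norm_mult by (intro mult_mono) auto
  then show ?thesis
    using \<open>A > 0\<close> \<open>B > 0\<close> that[of "A * B"] by simp
qed

lemma sum_telescope_eq:
  fixes G :: "nat \<Rightarrow> 'a::ab_group_add"
  assumes "\<And>s. s < n \<Longrightarrow> f s = G (Suc s) - G s" "G 0 = 0"
  shows "(\<Sum>s<n. f s) = G n"
proof -
  have "(\<Sum>s<n. f s) = (\<Sum>s<n. G (Suc s) - G s)"
    using assms by (intro sum.cong) auto
  then show ?thesis
    using assms(2) by (simp add: sum_lessThan_telescope)
qed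

lemma add_eq_of_diff_eq:
  fixes a b :: "'a::ab_group_add"
  assumes "a - b = d" "d + x = y"
  shows "a + x = b + y"
  using assms by (auto simp: algebra_simps)

text \<open>Shanks's finite forms of Gauss's identities: the difference in \<open>n\<close> of the summands on the right
  telescopes in \<open>s\<close> (the function \<open>G\<close>), and only the summand \<open>s = 0\<close> survives as \<open>n \<rightarrow> \<infinity>\<close>.\<close>

lemma gauss_squares_finite:
  fixes q :: complex
  assumes q: "norm q < 1"
  defines "P \<equiv> \<lambda>n. euler_part n q ^ 2 / euler_part n (q\<^sup>2)"
  shows "(\<Sum>s\<le>n. (if s = 0 then 1 else 2) * (-1) ^ s * q ^ (s\<^sup>2)) =
     (\<Sum>s\<le>n. 2 * (-1) ^ s / (1 + q ^ s) * (P n / P s) * q ^ (s * Suc n))"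
proof (induction n)
  case 0
  then show ?case by (simp add: P_def)
next
  case (Suc n)
  have q2: "norm (q\<^sup>2) < 1"
    using q by (rule norm_power_less_1) simp
  have Pnz: "P k \<noteq> 0" for k
    using euler_part_nz[OF q] euler_part_nz[OF q2] by (simp add: P_def)
  have plus: "1 + q ^ k \<noteq> 0" for k
  proof (cases "k = 0")
    case False
    have "1 - (q ^ k)\<^sup>2 \<noteq> 0"
      using one_minus_power_nz[OF q, of "k * 2"] False by (simp add: power_mult)
    then show ?thesis
      by (simp add: power2_eq_square) (metis add_eq_0_iff minus_mult_minus mult_1 diff_self)
  qed auto
  have minus: "1 - q ^ Suc k \<noteq> 0" for k
    using one_minus_power_nz[OF q, of "Suc k"] by simp
  have PS: "P (Suc k) = P k * (1 - q ^ Suc k) / (1 + q ^ Suc k)" for k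
  proof -
    have "(q\<^sup>2) ^ Suc k = (q ^ Suc k)\<^sup>2"
      by (simp only: power_mult[symmetric] mult.commute)
    then have "1 - (q\<^sup>2) ^ Suc k = (1 - q ^ Suc k) * (1 + q ^ Suc k)"
      by (simp add: power2_eq_square algebra_simps)
    then show ?thesis
      unfolding P_def euler_part_Suc using minus[of k] plus[of "Suc k"] euler_part_nz[OF q2, of k]
      by (simp add: divide_simps power2_eq_square del: power_Suc)
  qed
  define F where "F = (\<lambda>n s. 2 * (-1) ^ s / (1 + q ^ s) * (P n / P s) * q ^ (s * Suc n))"
  \<comment> \<open>The telescoping certificate in s; its factor 1 - q^s makes it vanish at s =
    0.\<close>
  define G where "G = (\<lambda>s. 2 * (-1) ^ s * (P n / P s) * (1 - q ^ s) / (1 + q ^ s) * q ^ (s * Suc n) / (1 + q ^ Suc n))"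
  have "(\<Sum>s<Suc n. F (Suc n) s - F n s) = G (Suc n)"
  proof (rule sum_telescope_eq)
    show "G 0 = 0"
      by (simp add: G_def)
  next
    fix s
    define x where "x = q ^ s"
    define z where "z = q ^ Suc n"
    define w where "w = q ^ (s * Suc n)"
    define v where "v = q ^ Suc s"
    have nz: "1 + x \<noteq> 0" "1 + z \<noteq> 0" "1 + v \<noteq> 0" "1 - v \<noteq> 0"
      using plus minus unfolding x_def z_def v_def by blast+
    have pw: "q ^ (s * Suc (Suc n)) = w * x" "q ^ (Suc s * Suc n) = w * z"
      by (simp_all add: x_def z_def w_def algebra_simps flip: power_add)
    show "F (Suc n) s - F n s = G (Suc s) - G s"
      unfolding F_def G_def PS pw 
      unfolding x_def[symmetric] z_def[symmetric] w_def[symmetric] v_def[symmetric]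
      using nz Pnz[of s] by (simp add: divide_simps) algebra
  qed
  \<comment> \<open>The upper boundary term and the new summand s = n + 1 combine to the next term
    of the theta series.\<close>
  moreover have "G (Suc n) + F (Suc n) (Suc n) = 2 * (-1) ^ Suc n * q ^ ((Suc n)\<^sup>2)"
  proof -
    define z where "z = q ^ Suc n"
    have nz: "1 + z \<noteq> 0" "1 - z \<noteq> 0"
      using plus minus unfolding z_def by blast+
    have pw: "q ^ (Suc n * Suc (Suc n)) = q ^ ((Suc n)\<^sup>2) * z" "q ^ (Suc n * Suc n) = q ^ ((Suc n)\<^sup>2)"
      by (simp_all add: z_def power2_eq_square add_ac flip: power_add)
    show ?thesis
      unfolding F_def G_def PS pw 
      unfolding z_def[symmetric]
      using nz Pnz[of n] by (simp add: divide_simps) algebra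
  qed
  ultimately have "(\<Sum>s\<le>Suc n. F (Suc n) s) = (\<Sum>s\<le>n. F n s) + 2 * (-1) ^ Suc n * q ^ ((Suc n)\<^sup>2)"
    by (simp only: sum_subtractf lessThan_Suc_atMost sum.atMost_Suc) (rule add_eq_of_diff_eq)
  then show ?case
    using Suc by (simp add: F_def)
qed

lemma gauss_triangular_finite:
  fixes q :: complex
  assumes q: "norm q < 1"
  defines "P \<equiv> \<lambda>n. euler_part n (q ^ 4) ^ 2 / euler_part (2 * n) (q\<^sup>2)"
  shows "(\<Sum>s<2*n. q ^ (s * (s + 1))) = (\<Sum>s<n. P n / P s * q ^ (2 * s * (2 * n + 1)))"
proof (induction n)
  case 0
  then show ?case by simp
next
  case (Suc n)
  have q2: "norm (q\<^sup>2) < 1" and q4: "norm (q ^ 4) < 1"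
    using q by (simp_all add: norm_power_less_1)
  have Pnz: "P k \<noteq> 0" for k
    using euler_part_nz[OF q2] euler_part_nz[OF q4] by (simp add: P_def)
  have minus: "1 - q ^ k \<noteq> 0" if "k > 0" for k
    using one_minus_power_nz[OF q that] .
  have PS: "P (Suc k) = P k * (1 - q ^ (4 * k + 4)) / (1 - q ^ (4 * k + 2))" for k
  proof -
    have "2 * Suc k = Suc (Suc (2 * k))"
      by simp
    moreover have "(q ^ 4) ^ Suc k = q ^ (4 * k + 4)" "(q\<^sup>2) ^ Suc (2 * k) = q ^ (4 * k + 2)"
      "(q\<^sup>2) ^ Suc (Suc (2 * k)) = q ^ (4 * k + 4)"
      unfolding power_mult[symmetric]
      by (rule arg_cong[where f = "\<lambda>i. q ^ i"], simp)+
    ultimately show ?thesis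
      unfolding P_def using minus[of "4 * k + 2"] minus[of "4 * k + 4"] euler_part_nz[OF q2, of "2 * k"]
      by (simp add: euler_part_Suc divide_simps power2_eq_square del: power_Suc)
  qed
  define F where "F = (\<lambda>n s. P n / P s * q ^ (2 * s * (2 * n + 1)))"
  define G where "G = (\<lambda>s. P n / P s * (1 - q ^ (4 * s)) * q ^ (2 * s * (2 * n + 1)) / (1 - q ^ (4 * n + 2)))"
  have "(\<Sum>s<n. F (Suc n) s - F n s) = G n"
  proof (rule sum_telescope_eq)
    show "G 0 = 0"
      by (simp add: G_def)
  next
    fix s
    define x where "x = q ^ (2 * s)"
    define z where "z = q ^ (2 * n + 1)"
    define w where "w = q ^ (2 * s * (2 * n + 1))"
    define k where "k = q ^ (4 * s + 2)"
    define l where "l = q ^ (4 * s + 4)"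
    have nz: "1 - z\<^sup>2 \<noteq> 0" "1 - k \<noteq> 0" "1 - l \<noteq> 0"
      using minus[of "(2 * n + 1) * 2"] minus[of "4 * s + 2"] minus[of "4 * s + 4"]
      unfolding z_def k_def l_def power_mult[symmetric] by auto
    have pw: "q ^ (2 * s * (2 * Suc n + 1)) = w * x\<^sup>2" "q ^ (2 * Suc s * (2 * n + 1)) = w * z\<^sup>2"
      "q ^ (4 * n + 2) = z\<^sup>2" "q ^ (4 * n + 4) = z\<^sup>2 * q\<^sup>2" "q ^ (4 * s) = x\<^sup>2"
      "q ^ (4 * Suc s) = l" "l = x\<^sup>2 * q ^ 4" "k = x\<^sup>2 * q\<^sup>2"
      unfolding x_def z_def w_def k_def l_def power_mult[symmetric] power_add[symmetric]
      by (rule arg_cong[where f = "\<lambda>i. q ^ i"], simp add: algebra_simps)+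
    show "F (Suc n) s - F n s = G (Suc s) - G s"
      unfolding F_def G_def PS pw(1-6)
      unfolding w_def[symmetric] k_def[symmetric] l_def[symmetric]
      using nz Pnz[of s] pw(7,8) by (simp add: divide_simps) (simp add: algebra_simps)
  qed
  \<comment> \<open>Here they combine to two new terms, those with indices 2n and 2n + 1.\<close>
  moreover have "G n + F (Suc n) n = q ^ (2 * n * (2 * n + 1)) + q ^ (Suc (2 * n) * (Suc (2 * n) + 1))"
  proof -
    define x where "x = q ^ (2 * n)"
    define w where "w = q ^ (2 * n * (2 * n + 1))"
    define k where "k = q ^ (4 * n + 2)"
    have nz: "1 - k \<noteq> 0"
      using minus[of "4 * n + 2"] unfolding k_def by auto
    have pw: "q ^ (2 * n * (2 * Suc n + 1)) = w * x\<^sup>2" "q ^ (4 * n) = x\<^sup>2"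
      "q ^ (4 * n + 4) = x\<^sup>2 * q ^ 4" "k = x\<^sup>2 * q\<^sup>2" "q ^ (Suc (2 * n) * (Suc (2 * n) + 1)) = w * k"
      unfolding x_def w_def k_def power_mult[symmetric] power_add[symmetric]
      by (rule arg_cong[where f = "\<lambda>i. q ^ i"], simp add: algebra_simps)+
    show ?thesis
      unfolding F_def G_def PS pw(1-3,5)
      unfolding w_def[symmetric] k_def[symmetric]
      using nz Pnz[of n] pw(4) by (simp add: divide_simps) (simp add: algebra_simps eval_nat_numeral)
  qed
  ultimately have "(\<Sum>s<Suc n. F (Suc n) s) = (\<Sum>s<n. F n s) +
      (q ^ (2 * n * (2 * n + 1)) + q ^ (Suc (2 * n) * (Suc (2 * n) + 1)))"
    by (simp only: sum_subtractf sum.lessThan_Suc) (rule add_eq_of_diff_eq)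
  then show ?case
    using Suc by (simp add: F_def)
qed


lemma gauss_squares_minus:
  assumes q: "norm q < 1"
  shows "(\<lambda>s. (if s = 0 then 1 else 2) * (-1) ^ s * q ^ (s\<^sup>2)) sums (euler_prod q ^ 2 / euler_prod (q\<^sup>2))"
  unfolding sums_def_le
proof -
  have q2: "norm (q\<^sup>2) < 1"
    using q by (rule norm_power_less_1) simp
  define P where "P = (\<lambda>n. euler_part n q ^ 2 / euler_part n (q\<^sup>2))"
  have lim: "P \<longlonglongrightarrow> euler_prod q ^ 2 / euler_prod (q\<^sup>2)"
    unfolding P_def using q q2 euler_prod_nz[OF q2] by (intro tendsto_intros euler_part_tendsto)
  obtain C where C: "C > 0" "\<And>n s. norm (P n / P s) \<le> C"
    using bounded_ratio[OF lim] euler_prod_nz[OF q] euler_prod_nz[OF q2] by auto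
  define t where "t = (\<lambda>n s. 2 * (-1) ^ s / (1 + q ^ s) * (P n / P s) * q ^ (s * Suc n))"
  show "(\<lambda>n. \<Sum>s\<le>n. (if s = 0 then 1 else 2) * (-1) ^ s * q ^ (s\<^sup>2)) \<longlonglongrightarrow> euler_prod q ^ 2 / euler_prod (q\<^sup>2)"
  proof (rule shanks_limit[OF lim norm_ge_zero q])
    fix n
    \<comment> \<open>At s = 0 the weight is 2 / (1 + q^0) = 1, and \<open>P 0\<close> is 1.\<close>
    have "t n 0 = P n"
      by (simp add: t_def P_def)
    moreover have "(\<Sum>s\<le>n. t n s) = t n 0 + (\<Sum>s\<in>{1..n}. t n s)"
      by (simp add: atMost_atLeast0 sum.atLeast_Suc_atMost)
    ultimately show "(\<Sum>s\<le>n. (if s = 0 then 1 else 2) * (-1) ^ s * q ^ (s\<^sup>2)) = P n + (\<Sum>s\<in>{1..n}. t n s)"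
      using gauss_squares_finite[OF q, of n] by (simp add: t_def P_def)
  next
    fix n s :: nat assume s: "s \<ge> 1"
    have "norm (q ^ s) \<le> norm q"
      using s q by (simp add: norm_power power_decreasing[of 1 s "norm q", simplified])
    then have "1 - norm q \<le> norm (1 + q ^ s)"
      using norm_diff_ineq[of 1 "q ^ s"] by simp
    then have 1: "norm (2 * (-1) ^ s / (1 + q ^ s)) \<le> 2 / (1 - norm q)"
      using q by (simp add: norm_divide norm_mult norm_power frac_le)
    have "n + s \<le> s * Suc n"
      using s by (cases s) auto
    then have 2: "norm (q ^ (s * Suc n)) \<le> norm q ^ (n + s)"
      using q unfolding norm_power by (intro power_decreasing) auto
    show "norm (t n s) \<le> (2 / (1 - norm q) * C) * norm q ^ (n + s)"
      unfolding t_def norm_mult[of _ "q ^ (s * Suc n)"] norm_mult[of _ "P n / P s"]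
      using 1 2 C q by (intro mult_mono mult_nonneg_nonneg) (auto intro: less_imp_le)
  qed
qed

text \<open>The finite identity reaches only partial sums of even length; summability identifies
  their limit with the full sum.\<close>

lemma gauss_triangular:
  assumes q: "norm q < 1"
  shows "(\<lambda>s. q ^ (s * (s + 1))) sums (euler_prod (q ^ 4) ^ 2 / euler_prod (q\<^sup>2))"
proof -
  have q2: "norm (q\<^sup>2) < 1" and q4: "norm (q ^ 4) < 1"
    using q by (simp_all add: norm_power_less_1)
  define P where "P = (\<lambda>n. euler_part n (q ^ 4) ^ 2 / euler_part (2 * n) (q\<^sup>2))"
  have lim: "P \<longlonglongrightarrow> euler_prod (q ^ 4) ^ 2 / euler_prod (q\<^sup>2)"
    unfolding P_def using q q2 q4 euler_prod_nz[OF q2]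
    by (intro tendsto_intros euler_part_tendsto filterlim_compose[OF euler_part_tendsto mult_nat_left_at_top]) simp_all
  obtain C where C: "C > 0" "\<And>n s. norm (P n / P s) \<le> C"
    using bounded_ratio[OF lim] euler_prod_nz[OF q4] euler_prod_nz[OF q2] by auto
  define t where "t = (\<lambda>n s. P n / P s * q ^ (2 * s * (2 * n + 1)))"
  have even: "(\<lambda>n. \<Sum>s<2*Suc n. q ^ (s * (s + 1))) \<longlonglongrightarrow> euler_prod (q ^ 4) ^ 2 / euler_prod (q\<^sup>2)"
  proof (rule shanks_limit[OF LIMSEQ_Suc[OF lim] norm_ge_zero q])
    fix n
    have "t (Suc n) 0 = P (Suc n)"
      by (simp add: t_def P_def)
    moreover have "(\<Sum>s<Suc n. t (Suc n) s) = t (Suc n) 0 + (\<Sum>s\<in>{1..n}. t (Suc n) s)"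
      by (simp only: lessThan_Suc_atMost) (simp add: atMost_atLeast0 sum.atLeast_Suc_atMost)
    ultimately show "(\<Sum>s<2*Suc n. q ^ (s * (s + 1))) = P (Suc n) + (\<Sum>s\<in>{1..n}. t (Suc n) s)"
      unfolding gauss_triangular_finite[OF q] by (simp add: t_def P_def)
  next
    fix n s :: nat assume s: "s \<ge> 1"
    have "n + s \<le> 2 * s * (2 * Suc n + 1)"
      using s by (cases s) auto
    then have 2: "norm (q ^ (2 * s * (2 * Suc n + 1))) \<le> norm q ^ (n + s)"
      using q unfolding norm_power by (intro power_decreasing) auto
    show "norm (t (Suc n) s) \<le> C * norm q ^ (n + s)"
      unfolding t_def norm_mult[of "P (Suc n) / P s"] using 2 C q by (intro mult_mono) (auto intro: less_imp_le)
  qed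
  have "summable (\<lambda>s. q ^ (s * (s + 1)))"
  proof (rule summable_comparison_test')
    show "summable (\<lambda>s. norm q ^ s)"
      using q by (intro summable_geometric) auto
    show "norm (q ^ (s * (s + 1))) \<le> norm q ^ s" for s
      using q unfolding norm_power by (intro power_decreasing) auto
  qed
  then have sums: "(\<lambda>s. q ^ (s * (s + 1))) sums (\<Sum>s. q ^ (s * (s + 1)))"
    by (rule summable_sums)
  have "strict_mono (\<lambda>n::nat. 2 * Suc n)"
    by (rule strict_monoI) simp
  from LIMSEQ_subseq_LIMSEQ[OF sums[unfolded sums_def] this]
  have "(\<lambda>n. \<Sum>s<2*Suc n. q ^ (s * (s + 1))) \<longlonglongrightarrow> (\<Sum>s. q ^ (s * (s + 1)))"
    by (simp add: o_def)
  then have "(\<Sum>s. q ^ (s * (s + 1))) = euler_prod (q ^ 4) ^ 2 / euler_prod (q\<^sup>2)"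
    using even by (rule LIMSEQ_unique)
  with sums show ?thesis
    by simp
qed

section \<open>Theta functions and their relations under squaring of the nome\<close>

definition th3 :: "complex \<Rightarrow> complex" where
  "th3 q = euler_prod (q\<^sup>2) ^ 5 / (euler_prod q ^ 2 * euler_prod (q ^ 4) ^ 2)"

definition th4 :: "complex \<Rightarrow> complex" where
  "th4 q = euler_prod q ^ 2 / euler_prod (q\<^sup>2)"

text \<open>Jacobi's theta_2 is 2 q^(1/4) times this function, which itself is free of fractional
  powers.\<close>

definition rho :: "complex \<Rightarrow> complex" where
  "rho q = euler_prod (q ^ 4) ^ 2 / euler_prod (q\<^sup>2)"

lemma th4_minus:
  assumes "norm q < 1"
  shows "th4 (-q) = th3 q"
proof -
  have nz: "euler_prod q \<noteq> 0" "euler_prod (-q) \<noteq> 0" "euler_prod (q\<^sup>2) \<noteq> 0" "euler_prod (q ^ 4) \<noteq> 0"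
    using assms by (auto intro!: euler_prod_nz norm_power_less_1)
  have *: "euler_prod (-q) = euler_prod (q\<^sup>2) ^ 3 / (euler_prod q * euler_prod (q ^ 4))"
    using euler_prod_minus[OF assms] nz by (simp add: field_simps)
  show ?thesis
    using nz unfolding th3_def th4_def * power2_minus by (simp add: field_simps eval_nat_numeral)
qed

lemma th3_mult_th4:
  assumes "norm q < 1"
  shows "th3 q * th4 q = th4 (q\<^sup>2) ^ 2"
proof -
  have nz: "euler_prod q \<noteq> 0" "euler_prod (q\<^sup>2) \<noteq> 0" "euler_prod (q ^ 4) \<noteq> 0"
    using assms by (auto intro!: euler_prod_nz norm_power_less_1)
  have "(q\<^sup>2)\<^sup>2 = q ^ 4"
    by (simp flip: power_mult)
  then show ?thesis
    using nz by (simp add: th3_def th4_def field_simps eval_nat_numeral)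
qed

lemma rho_squared:
  assumes "norm q < 1"
  shows "rho q ^ 2 = rho (q\<^sup>2) * th3 (q\<^sup>2)"
proof -
  have nz: "euler_prod (q\<^sup>2) \<noteq> 0" "euler_prod (q ^ 4) \<noteq> 0" "euler_prod (q ^ 8) \<noteq> 0"
    using assms by (auto intro!: euler_prod_nz norm_power_less_1)
  have q: "(q\<^sup>2)\<^sup>2 = q ^ 4" "(q\<^sup>2) ^ 4 = q ^ 8"
    by (simp_all flip: power_mult)
  show ?thesis
    using nz unfolding rho_def th3_def q by (simp add: field_simps) (simp add: eval_nat_numeral)
qed

lemma th3_sums:
  assumes "norm q < 1"
  shows "(\<lambda>s. (if s = 0 then 1 else 2) * q ^ (s\<^sup>2)) sums th3 q"
proof -
  have "(-1) ^ s * (-q) ^ (s\<^sup>2) = q ^ (s\<^sup>2)" for s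
    by (cases "even s") (simp_all add: power_minus_odd)
  then show ?thesis
    using gauss_squares_minus[of "-q"] assms
    by (simp add: mult.assoc flip: th4_minus) (simp add: th4_def)
qed

lemma rho_sums:
  assumes "norm q < 1"
  shows "(\<lambda>s. q ^ (s * (s + 1))) sums rho q"
  unfolding rho_def by (rule gauss_triangular[OF assms])

text \<open>Even and odd indices are separated: (2s)^2 = 4 s^2 and (2s + 1)^2 = 4 s (s + 1) +
  1.\<close>

lemma th3_dissection:
  assumes "norm q < 1"
  shows "th3 q = th3 (q ^ 4) + 2 * q * rho (q ^ 4)"
proof -
  define f where "f = (\<lambda>s. (if s = 0 then 1 else 2) * q ^ (s\<^sup>2))"
  have "norm (q ^ 4) < 1"
    using assms by (simp add: norm_power_less_1)
  then have "(\<lambda>s. (if s = 0 then 1 else 2) * (q ^ 4) ^ (s\<^sup>2) + 2 * q * (q ^ 4) ^ (s * (s + 1)))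
      sums (th3 (q ^ 4) + 2 * q * rho (q ^ 4))"
    by (intro sums_add sums_mult th3_sums rho_sums)
  also have "(\<lambda>s. (if s = 0 then 1 else 2) * (q ^ 4) ^ (s\<^sup>2) + 2 * q * (q ^ 4) ^ (s * (s + 1))) =
      (\<lambda>s. sum f {s * 2..<s * 2 + 2})"
  proof
    fix s
    have 1: "(s * 2)\<^sup>2 = 4 * s\<^sup>2" and 2: "(Suc (s * 2))\<^sup>2 = Suc (4 * (s * (s + 1)))"
      by (simp_all add: power2_eq_square algebra_simps)
    have "sum f {s * 2..<s * 2 + 2} = f (s * 2) + f (Suc (s * 2))"
      by (simp add: eval_nat_numeral)
    also have "\<dots> = (if s = 0 then 1 else 2) * (q ^ 4) ^ (s\<^sup>2) + 2 * q * (q ^ 4) ^ (s * (s + 1))"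
      unfolding f_def 1 2 power_Suc power_mult by simp
    finally show "(if s = 0 then 1 else 2) * (q ^ 4) ^ (s\<^sup>2) + 2 * q * (q ^ 4) ^ (s * (s + 1)) =
       sum f {s * 2..<s * 2 + 2}" by simp
  qed
  finally have "(\<lambda>s. sum f {s * 2..<s * 2 + 2}) sums (th3 (q ^ 4) + 2 * q * rho (q ^ 4))" .
  moreover have "(\<lambda>s. sum f {s * 2..<s * 2 + 2}) sums th3 q"
    unfolding f_def by (intro sums_group th3_sums assms) simp
  ultimately show ?thesis
    by (rule sums_unique2[symmetric])
qed

text \<open>Squaring the dissection gives A^2 + 4 q^2 B^2 and a cross term in A B. The cross term is
  \<open>rho_squared\<close>. The sum of squares is \<open>th3 * th4\<close> at i q, because (i q)^4
  = q^4 while (i q)^2 changes sign.\<close>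

lemma th3_squared:
  assumes "norm q < 1"
  shows "th3 q ^ 2 = th3 (q\<^sup>2) ^ 2 + 4 * q * rho (q\<^sup>2) ^ 2"
    and "th4 q ^ 2 = th3 (q\<^sup>2) ^ 2 - 4 * q * rho (q\<^sup>2) ^ 2"
proof -
  define A where "A = th3 (q ^ 4)"
  define B where "B = rho (q ^ 4)"
  have q2: "norm (q\<^sup>2) < 1"
    using assms by (simp add: norm_power_less_1)
  have i4: "(\<i> * q) ^ 4 = q ^ 4" "(\<i> * q)\<^sup>2 = - (q\<^sup>2)" "(q\<^sup>2)\<^sup>2 = q ^ 4"
    by (simp_all add: power_mult_distrib flip: power_mult)
  have 3: "th3 r = th3 (r ^ 4) + 2 * r * rho (r ^ 4)" "th4 r = th3 (r ^ 4) - 2 * r * rho (r ^ 4)" if "norm r < 1" for r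
    using th3_dissection[of r] th3_dissection[of "-r"] th4_minus[of "-r"] that by simp_all
  have iq: "norm (\<i> * q) < 1"
    using assms by (simp add: norm_mult)
  have "th3 (\<i> * q) * th4 (\<i> * q) = th3 (q\<^sup>2) ^ 2"
    using th3_mult_th4[OF iq] th4_minus[OF q2] by (simp add: i4)
  then have "(A + 2 * (\<i> * q) * B) * (A - 2 * (\<i> * q) * B) = th3 (q\<^sup>2) ^ 2"
    using 3[OF iq] unfolding i4 A_def B_def by simp
  then have 1: "A\<^sup>2 + 4 * q\<^sup>2 * B\<^sup>2 = th3 (q\<^sup>2) ^ 2"
    by (simp add: algebra_simps power2_eq_square)
  have 2: "A * B = rho (q\<^sup>2) ^ 2"
    using rho_squared[OF q2] by (simp add: i4 A_def B_def)
  show "th3 q ^ 2 = th3 (q\<^sup>2) ^ 2 + 4 * q * rho (q\<^sup>2) ^ 2"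
    using 3(1)[OF assms] 1 2 unfolding A_def[symmetric] B_def[symmetric] by algebra
  show "th4 q ^ 2 = th3 (q\<^sup>2) ^ 2 - 4 * q * rho (q\<^sup>2) ^ 2"
    using 3(2)[OF assms] 1 2 unfolding A_def[symmetric] B_def[symmetric] by algebra
qed

section \<open>The expansion of the form at infinity\<close>

definition fps_th3 :: "complex fps" where
  "fps_th3 = Abs_fps (\<lambda>n. if n = 0 then 1 else if \<exists>s. n = s\<^sup>2 then 2 else 0)"

definition fps_rho :: "complex fps" where
  "fps_rho = Abs_fps (\<lambda>n. if \<exists>s. n = s * (s + 1) then 1 else 0)"

lemma eventually_norm_less: "r > 0 \<Longrightarrow> eventually (\<lambda>x::complex. norm x < r) (nhds 0)"
  unfolding eventually_nhds_metric by (auto intro!: exI[of _ r])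

lemma th3_has_fps_expansion: "th3 has_fps_expansion fps_th3"
proof (rule has_fps_expansionI, rule eventually_mono[OF eventually_norm_less[of 1]])
  fix u :: complex assume u: "norm u < 1"
  have "strict_mono (\<lambda>s::nat. s\<^sup>2)"
    by (rule strict_monoI) (simp add: power_strict_mono)
  then have "(\<lambda>s. fps_nth fps_th3 (s\<^sup>2) * u ^ (s\<^sup>2)) sums th3 u \<longleftrightarrow> (\<lambda>n. fps_nth fps_th3 n * u ^ n) sums th3 u"
  proof (rule sums_mono_reindex)
    fix n :: nat assume n: "n \<notin> range (\<lambda>s. s\<^sup>2)"
    then have "n \<noteq> 0"
      by (metis power_zero_numeral rangeI)
    with n show "fps_nth fps_th3 n * u ^ n = 0"
      by (auto simp: fps_th3_def)
  qed
  moreover have "fps_nth fps_th3 (s\<^sup>2) = (if s = 0 then 1 else 2)" for s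
    by (auto simp: fps_th3_def)
  ultimately show "(\<lambda>n. fps_nth fps_th3 n * u ^ n) sums th3 u"
    using th3_sums[OF u] by simp
qed simp

lemma rho_has_fps_expansion: "rho has_fps_expansion fps_rho"
proof (rule has_fps_expansionI, rule eventually_mono[OF eventually_norm_less[of 1]])
  fix u :: complex assume u: "norm u < 1"
  have "strict_mono (\<lambda>s::nat. s * (s + 1))"
    by (rule strict_monoI) (intro mult_strict_mono, auto)
  then have "(\<lambda>s. fps_nth fps_rho (s * (s + 1)) * u ^ (s * (s + 1))) sums rho u \<longleftrightarrow> (\<lambda>n. fps_nth fps_rho n * u ^ n) sums rho u"
    by (rule sums_mono_reindex) (auto simp: fps_rho_def image_iff)
  moreover have "fps_nth fps_rho (s * (s + 1)) = 1" for s
    by (auto simp: fps_rho_def)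
  ultimately show "(\<lambda>n. fps_nth fps_rho n * u ^ n) sums rho u"
    using rho_sums[OF u] by simp
qed simp

lemma has_fps_expansion_dilate2:
  fixes f :: "complex \<Rightarrow> complex"
  assumes "f has_fps_expansion F"
  shows "(\<lambda>x. f (x\<^sup>2)) has_fps_expansion dilate2 F"
  using has_fps_expansion_compose[OF assms has_fps_expansion_fps_X_power[of 2]]
  by (simp add: o_def dilate2_def)

lemma fps_expansion_eq:
  fixes f g :: "complex \<Rightarrow> complex"
  assumes "f has_fps_expansion F" "g has_fps_expansion G" "eventually (\<lambda>x. f x = g x) (nhds 0)"
  shows "F = G"
proof -
  have "f has_fps_expansion G"
    using assms(2,3) unfolding has_fps_expansion_def by (auto elim: eventually_elim2)
  with assms(1) show ?thesis
    by (rule fps_expansion_unique_complex)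
qed

definition theta3_sq :: "complex \<Rightarrow> complex" where "theta3_sq x = th3 (x\<^sup>2) ^ 2"
text \<open>The square of theta_2 at nome x^2; squaring removes the half-integral power of
  x.\<close>

definition theta2_sq :: "complex \<Rightarrow> complex" where "theta2_sq x = 4 * (x * rho (x\<^sup>2) ^ 2)"

definition fps_theta3_sq :: "complex fps" where "fps_theta3_sq = dilate2 fps_th3 ^ 2"
text \<open>The factor 4 is split off so that the integrality of c / 4 is available for
  \<open>y\<close>.\<close>

definition fps_theta2_sq_quarter :: "complex fps" where "fps_theta2_sq_quarter = fps_X * dilate2 fps_rho ^ 2"

lemma theta3_sq_has_fps_expansion: "theta3_sq has_fps_expansion fps_theta3_sq"
  unfolding theta3_sq_def fps_theta3_sq_def
  by (intro has_fps_expansion_power has_fps_expansion_dilate2 th3_has_fps_expansion)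

lemma theta2_sq_has_fps_expansion: "theta2_sq has_fps_expansion 4 * fps_theta2_sq_quarter"
  unfolding theta2_sq_def fps_theta2_sq_quarter_def
  by (intro has_fps_expansion_mult has_fps_expansion_fps_X has_fps_expansion_numeral
      has_fps_expansion_power has_fps_expansion_dilate2 rho_has_fps_expansion)

lemma int_coeffs_fps_theta3_sq: "int_coeffs fps_theta3_sq"
  unfolding fps_theta3_sq_def by (intro int_coeffs_power int_coeffs_dilate2) (simp add: int_coeffs_def fps_th3_def)

lemma int_coeffs_fps_theta2_sq_quarter: "int_coeffs fps_theta2_sq_quarter"
  unfolding fps_theta2_sq_quarter_def
  by (intro int_coeffs_mult int_coeffs_power int_coeffs_dilate2) (simp_all add: int_coeffs_def fps_rho_def)

lemma theta3_sq_landen: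
  assumes "norm x < 1"
  shows "theta3_sq x = theta3_sq (x\<^sup>2) + theta2_sq (x\<^sup>2)"
  using th3_squared(1)[of "x\<^sup>2"] assms by (simp add: theta3_sq_def theta2_sq_def norm_power_less_1)

lemma theta2_sq_landen:
  assumes "norm x < 1"
  shows "theta2_sq x ^ 2 = 4 * theta3_sq (x\<^sup>2) * theta2_sq (x\<^sup>2)"
proof -
  have "rho (x\<^sup>2) ^ 2 = rho ((x\<^sup>2)\<^sup>2) * th3 ((x\<^sup>2)\<^sup>2)"
    using assms by (intro rho_squared norm_power_less_1) simp_all
  then show ?thesis
    unfolding theta3_sq_def theta2_sq_def by algebra
qed

lemma th4_squared_landen:
  assumes "norm x < 1"
  shows "th4 (x\<^sup>2) ^ 2 = theta3_sq (x\<^sup>2) - theta2_sq (x\<^sup>2)"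
  using th3_squared(2)[of "x\<^sup>2"] assms by (simp add: theta3_sq_def theta2_sq_def norm_power_less_1)

text \<open>With A and C the values at x^2, this is (A - C)^2 = (A + C)^2 - 4 A C.\<close>

lemma jacobi_quartic:
  assumes "norm x < 1"
  shows "th4 (x\<^sup>2) ^ 4 = theta3_sq x ^ 2 - theta2_sq x ^ 2"
proof -
  have "th4 (x\<^sup>2) ^ 4 = (th4 (x\<^sup>2) ^ 2)\<^sup>2"
    by simp
  also have "\<dots> = theta3_sq x ^ 2 - theta2_sq x ^ 2"
    using th4_squared_landen[OF assms] theta3_sq_landen[OF assms] theta2_sq_landen[OF assms] by algebra
  finally show ?thesis .
qed

interpretation theta: landen_pair fps_theta3_sq "4 * fps_theta2_sq_quarter"
proof
  have ev: "eventually (\<lambda>x::complex. norm x < 1) (nhds 0)"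
    by (rule eventually_norm_less) simp
  show "fps_theta3_sq = dilate2 fps_theta3_sq + dilate2 (4 * fps_theta2_sq_quarter)"
  proof (rule fps_expansion_eq[OF theta3_sq_has_fps_expansion])
    show "(\<lambda>x. theta3_sq (x\<^sup>2) + theta2_sq (x\<^sup>2)) has_fps_expansion dilate2 fps_theta3_sq + dilate2 (4 * fps_theta2_sq_quarter)"
      by (intro has_fps_expansion_add has_fps_expansion_dilate2 theta3_sq_has_fps_expansion theta2_sq_has_fps_expansion)
  qed (rule eventually_mono[OF ev theta3_sq_landen])
  show "(4 * fps_theta2_sq_quarter)\<^sup>2 = 4 * dilate2 fps_theta3_sq * dilate2 (4 * fps_theta2_sq_quarter)"
  proof (rule fps_expansion_eq)
    show "(\<lambda>x. theta2_sq x ^ 2) has_fps_expansion (4 * fps_theta2_sq_quarter)\<^sup>2"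
      by (intro has_fps_expansion_power theta2_sq_has_fps_expansion)
    show "(\<lambda>x. 4 * theta3_sq (x\<^sup>2) * theta2_sq (x\<^sup>2)) has_fps_expansion 4 * dilate2 fps_theta3_sq * dilate2 (4 * fps_theta2_sq_quarter)"
      by (intro has_fps_expansion_mult has_fps_expansion_numeral has_fps_expansion_dilate2
          theta3_sq_has_fps_expansion theta2_sq_has_fps_expansion)
  qed (rule eventually_mono[OF ev theta2_sq_landen])
  show "fps_nth fps_theta3_sq 0 = 1"
    by (simp add: fps_theta3_sq_def fps_power_zeroth dilate2_nth fps_th3_def)
  show "fps_nth (4 * fps_theta2_sq_quarter) 0 = 0" "fps_nth (4 * fps_theta2_sq_quarter) 1 = 4"
    by (simp_all add: fps_theta2_sq_quarter_def fps_power_zeroth dilate2_nth fps_rho_def)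
qed

section \<open>Eta quotients in terms of theta functions, and the expansion of
  \<open>phi\<close>\<close>

lemma norm_qz_less_1: "Im z > 0 \<Longrightarrow> norm (qz z) < 1"
  by (simp add: qz_def)

text \<open>All fractional powers become powers of one fixed 24th root of \<open>qz z\<close>, so no
  choice of branch arises later.\<close>

lemma dedekind_eta_mult:
  "dedekind_eta (of_nat m * z) = exp (2 * of_real pi * \<i> * z / 24) ^ m * euler_prod (qz z ^ m)"
proof -
  have "qz (of_nat m * z) = qz z ^ m"
    unfolding qz_def exp_of_nat_mult[symmetric] by (simp add: mult_ac)
  moreover have "exp (2 * of_real pi * \<i> * (of_nat m * z) / 24) = exp (2 * of_real pi * \<i> * z / 24) ^ m"
    unfolding exp_of_nat_mult[symmetric] by (simp add: mult_ac)
  ultimately show ?thesis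
    by (simp add: dedekind_eta_def euler_prod_def)
qed

text \<open>With k = 16 psi(2z) = c^2 / a^2 the rational factor of \<open>phi\<close> is (1 - 6k +
  k^2) / (1 + k)^2. The assumption \<open>nz\<close> excludes its poles.\<close>

lemma phi_eq:
  assumes "Im z > 0"
  defines "x \<equiv> qz z"
  defines "a \<equiv> theta3_sq x" and "c \<equiv> theta2_sq x"
  assumes nz: "a\<^sup>2 + c\<^sup>2 \<noteq> 0"
  shows "4 * phi z * (a\<^sup>2 + c\<^sup>2)\<^sup>2 = c * a * (a\<^sup>2 - c\<^sup>2) * (a^4 - 6 * a\<^sup>2 * c\<^sup>2 + c^4)"
proof -
  have x: "norm x < 1"
    unfolding x_def using assms(1) by (rule norm_qz_less_1)
  define e where "e = exp (2 * of_real pi * \<i> * z / 24)"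
  define E2 E4 E8 where "E2 = euler_prod (x\<^sup>2)" and "E4 = euler_prod (x^4)" and "E8 = euler_prod (x^8)"
  have E: "E2 \<noteq> 0" "E4 \<noteq> 0" "E8 \<noteq> 0"
    unfolding E2_def E4_def E8_def using x by (auto intro!: euler_prod_nz norm_power_less_1)
  have e: "e \<noteq> 0" and ex: "e ^ 24 = x"
    unfolding e_def x_def qz_def exp_of_nat_mult[symmetric] by (simp_all add: mult_ac)
  have eta: "dedekind_eta (2 * z) = e\<^sup>2 * E2" "dedekind_eta (4 * z) = e ^ 4 * E4"
    "dedekind_eta (4 * (2 * z)) = e ^ 8 * E8" "dedekind_eta (2 * (2 * z)) = e ^ 4 * E4"
    using dedekind_eta_mult[of 2 z] dedekind_eta_mult[of 4 z] dedekind_eta_mult[of 8 z]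
    by (simp_all add: e_def E2_def E4_def E8_def x_def)
  have Q: "(x\<^sup>2)\<^sup>2 = x ^ 4" "(x\<^sup>2) ^ 4 = x ^ 8"
    by (simp_all flip: power_mult)
  have a: "a = (E4 ^ 5 / (E2\<^sup>2 * E8\<^sup>2))\<^sup>2" and c: "c = 4 * (x * (E8\<^sup>2 / E4)\<^sup>2)"
    unfolding a_def c_def theta3_sq_def theta2_sq_def th3_def rho_def Q E2_def E4_def E8_def by simp_all
  have a_nz: "a \<noteq> 0"
    unfolding a using E by simp
  have b: "(E2\<^sup>2 / E4) ^ 4 = a\<^sup>2 - c\<^sup>2"
    using jacobi_quartic[OF x] unfolding th4_def Q E2_def E4_def a_def c_def by simp
  have "psi (2 * z) = (e ^ 24)\<^sup>2 * (E2 ^ 8 * E8 ^ 16 / E4 ^ 24)"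
  proof -
    have "(e\<^sup>2) ^ 8 * (e ^ 8) ^ 16 = (e ^ 24)\<^sup>2 * (e ^ 4) ^ 24"
      by (simp flip: power_mult power_add)
    then have "psi (2 * z) = ((e ^ 24)\<^sup>2 * (e ^ 4) ^ 24) * (E2 ^ 8 * E8 ^ 16) / ((e ^ 4) ^ 24 * E4 ^ 24)"
      unfolding psi_def eta power_mult_distrib by (simp add: mult_ac)
    also have "\<dots> = (e ^ 24)\<^sup>2 * (E2 ^ 8 * E8 ^ 16 / E4 ^ 24)"
    proof -
      have "A * B * C / (B * D) = A * (C / D)" if "B \<noteq> 0" for A B C D :: complex
        using that by simp
      then show ?thesis
        using e by (meson power_not_zero)
    qed
    finally show ?thesis .
  qed
  then have psi: "16 * psi (2 * z) * a\<^sup>2 = c\<^sup>2"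
    unfolding ex a c using E by (simp add: field_simps)
  have f: "4 * (dedekind_eta (2 * z) * dedekind_eta (4 * z)) ^ 4 = c * a * (a\<^sup>2 - c\<^sup>2)"
  proof -
    have "(dedekind_eta (2 * z) * dedekind_eta (4 * z)) ^ 4 = e ^ 24 * (E2 * E4) ^ 4"
      unfolding eta by (simp add: power_mult_distrib flip: power_mult power_add)
    also have "4 * \<dots> = c * a * (E2\<^sup>2 / E4) ^ 4"
      unfolding ex a c using E by (simp add: field_simps)
    finally show ?thesis
      by (simp add: b)
  qed
  define k where "k = 16 * psi (2 * z)"
  have k: "k * a\<^sup>2 = c\<^sup>2"
    using psi by (simp add: k_def)
  then have k_nz: "1 + k \<noteq> 0"
    using nz by (metis add.commute add_eq_0_iff mult_minus1 neg_eq_iff_add_eq_0 add_left_imp_eq)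
  have 1: "4 * phi z * (1 + k)\<^sup>2 = c * a * (a\<^sup>2 - c\<^sup>2) * (1 - 6 * k + k\<^sup>2)"
  proof -
    have "1 - 96 * psi (2 * z) + 256 * psi (2 * z) ^ 2 = 1 - 6 * k + k\<^sup>2"
      by (simp add: k_def power2_eq_square)
    then show ?thesis
      unfolding f[symmetric] phi_def using k_nz by (simp add: k_def)
  qed
  have 2: "(1 + k)\<^sup>2 * a ^ 4 = (a\<^sup>2 + c\<^sup>2)\<^sup>2" "(1 - 6 * k + k\<^sup>2) * a ^ 4 = a^4 - 6 * a\<^sup>2 * c\<^sup>2 + c^4"
    using k by algebra+
  have "4 * phi z * (a\<^sup>2 + c\<^sup>2)\<^sup>2 = (4 * phi z * (1 + k)\<^sup>2) * a ^ 4"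
    unfolding 2(1)[symmetric] by (simp only: mult_ac)
  also have "\<dots> = c * a * (a\<^sup>2 - c\<^sup>2) * (a^4 - 6 * a\<^sup>2 * c\<^sup>2 + c^4)"
    unfolding 1 2(2)[symmetric] by (simp only: mult_ac)
  finally show ?thesis .
qed

text \<open>A punctured neighbourhood of 0 is covered by values of \<open>qz\<close>, with Im z
  large enough both for the eta products and for the given expansion.\<close>

lemma ex_qz:
  assumes "x \<noteq> 0" "norm x < 1" "norm x < exp (- 2 * pi * Y)"
  obtains z where "x = qz z" "Im z > 0" "Im z > Y"
proof
  define z where "z = Ln x / (2 * of_real pi * \<i>)"
  show "x = qz z"
    using assms(1) by (simp add: z_def qz_def)
  have *: "Im z = - ln (norm x) / (2 * pi)"
    using assms(1) by (simp add: z_def Im_divide power2_eq_square)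
  show "Im z > 0"
    using assms divide_neg_pos[of "ln (norm x)" "2 * pi"] by (simp add: *)
  have "ln (norm x) < - 2 * pi * Y"
    using assms ln_less_cancel_iff[of "norm x" "exp (- 2 * pi * Y)"] by simp
  then show "Im z > Y"
    unfolding * by (subst pos_less_divide_eq) (simp_all add: algebra_simps)
qed

lemma phi_fps:
  fixes a :: "nat \<Rightarrow> int"
  assumes "has_fourier_expansion_at_ii_inf phi (\<lambda>n. of_int (a n)) {n. n \<ge> 1 \<and> odd n}"
  shows "Abs_fps (\<lambda>n. if odd n then of_int (a n) else 0) = theta.g * theta.Z\<^sup>2 * theta.y"
proof -
  define F where "F = Abs_fps (\<lambda>n. if odd n then of_int (a n) else 0 :: complex)"
  obtain Y where Y: "\<And>z. Im z > Y \<Longrightarrow> ((\<lambda>n. of_int (a n) * qz z ^ n) has_sum phi z) {n. n \<ge> 1 \<and> odd n}"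
    using assms unfolding has_fourier_expansion_at_ii_inf_def by blast
  define Zf where "Zf = (\<lambda>x. theta3_sq x ^ 2 + theta2_sq x ^ 2)"
  define N where "N = (\<lambda>x. theta2_sq x * theta3_sq x * (theta3_sq x ^ 2 - theta2_sq x ^ 2) * (theta3_sq x ^ 4 - 6 * theta3_sq x ^ 2 * theta2_sq x ^ 2 + theta2_sq x ^ 4))"
  define h where "h = (\<lambda>x. N x / (4 * Zf x ^ 2))"
  have Zf: "Zf has_fps_expansion theta.Z"
    unfolding Zf_def theta.Z_def
    by (intro has_fps_expansion_add has_fps_expansion_power theta3_sq_has_fps_expansion theta2_sq_has_fps_expansion)
  have "isCont Zf 0"
    using has_fps_expansion_imp_continuous[OF Zf] by simp
  then have "(Zf \<longlongrightarrow> Zf 0) (nhds 0)"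
    by (simp add: isCont_def tendsto_at_iff_tendsto_nhds)
  moreover have "Zf 0 \<noteq> 0"
    using has_fps_expansion_imp_0_eq_fps_nth_0[OF Zf] theta.Z_0 by simp
  ultimately have Zf_nz: "eventually (\<lambda>x. Zf x \<noteq> 0) (nhds 0)"
    by (rule tendsto_imp_eventually_ne)
  have "h has_fps_expansion F"
  proof (rule has_fps_expansionI)
    have "eventually (\<lambda>x::complex. norm x < 1) (nhds 0)" "eventually (\<lambda>x::complex. norm x < exp (- 2 * pi * Y)) (nhds 0)"
      by (rule eventually_norm_less, simp)+
    with Zf_nz show "\<forall>\<^sub>F u in nhds 0. (\<lambda>n. fps_nth F n * u ^ n) sums h u"
    proof eventually_elim
      case (elim u)
      show ?case
      \<comment> \<open>The point 0 is not a value of \<open>qz\<close>; there both the series,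
        whose constant coefficient is 0, and \<open>h\<close> vanish.\<close>
      proof (cases "u = 0")
        case True
        have "(\<lambda>n. fps_nth F n * u ^ n) = (\<lambda>_. 0)"
          by (auto simp: F_def True)
        then show ?thesis
          by (simp add: h_def N_def theta2_sq_def True)
      next
        case False
        obtain z where z: "u = qz z" "Im z > 0" "Im z > Y"
          using ex_qz[OF False elim(2,3)] .
        have "((\<lambda>n. fps_nth F n * u ^ n) has_sum phi z) UNIV"
          using Y[OF z(3)] unfolding z(1)
          by (rule has_sum_cong_neutral[THEN iffD1, rotated -1]) (auto simp: F_def elim: oddE)
        moreover have "phi z = h u"
          using phi_eq[OF z(2)] elim(1) unfolding z(1)[symmetric] Zf_def h_def N_def
          by (simp add: field_simps)
        ultimately show ?thesis
          by (simp add: has_sum_imp_sums)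
      qed
    qed
  qed
  then have "(\<lambda>x. 4 * h x * Zf x ^ 2) has_fps_expansion 4 * F * theta.Z\<^sup>2"
    by (intro has_fps_expansion_mult has_fps_expansion_numeral has_fps_expansion_power Zf)
  moreover have "N has_fps_expansion 4 * fps_theta2_sq_quarter * fps_theta3_sq * (fps_theta3_sq\<^sup>2 - (4 * fps_theta2_sq_quarter)\<^sup>2) *
      (fps_theta3_sq ^ 4 - 6 * fps_theta3_sq\<^sup>2 * (4 * fps_theta2_sq_quarter)\<^sup>2 + (4 * fps_theta2_sq_quarter) ^ 4)"
    unfolding N_def
    by (intro has_fps_expansion_mult has_fps_expansion_add has_fps_expansion_diff has_fps_expansion_numeral
        has_fps_expansion_power theta3_sq_has_fps_expansion theta2_sq_has_fps_expansion)
  moreover have "\<forall>\<^sub>F x in nhds 0. 4 * h x * Zf x ^ 2 = N x"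
    using Zf_nz by eventually_elim (simp add: h_def)
  ultimately have "4 * F * theta.Z\<^sup>2 = 4 * fps_theta2_sq_quarter * fps_theta3_sq * (fps_theta3_sq\<^sup>2 - (4 * fps_theta2_sq_quarter)\<^sup>2) *
      (fps_theta3_sq ^ 4 - 6 * fps_theta3_sq\<^sup>2 * (4 * fps_theta2_sq_quarter)\<^sup>2 + (4 * fps_theta2_sq_quarter) ^ 4)"
    by (rule fps_expansion_eq)
  also have "\<dots> = (4 * theta.y * theta.Z\<^sup>2) * (theta.g * theta.Z\<^sup>2)"
    by (simp only: theta.four_y theta.g_Z)
  finally have "(4 * theta.Z\<^sup>2) * F = (4 * theta.Z\<^sup>2) * (theta.g * theta.Z\<^sup>2 * theta.y)"
    by (simp only: mult_ac)
  moreover have "4 * theta.Z\<^sup>2 \<noteq> 0"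
    using theta.Z_nz by simp
  ultimately show ?thesis
    unfolding F_def[symmetric] by (rule mult_left_cancel[THEN iffD1, rotated])
qed

theorem mainTheorem6:
  fixes a :: "nat \<Rightarrow> int" and p :: nat
  assumes "has_fourier_expansion_at_ii_inf phi (\<lambda>n. of_int (a n)) {n. n \<ge> 1 \<and> odd n}"
    and "prime p" and "odd p"
  shows "int p ^ 3 dvd a p - int p"
proof -
  \<comment> \<open>The hypothesis constrains \<open>a\<close> only at odd indices, so even
    coefficients are set to 0 to match the power series.\<close>
  define \<alpha> where "\<alpha> = (\<lambda>n. if odd n then a n else 0)"
  have "of_int (\<alpha> n) = fps_nth (theta.g * theta.Z\<^sup>2 * theta.y) n" for n
    by (simp add: \<alpha>_def flip: phi_fps[OF assms(1)])
  then have "int p ^ 3 dvd \<alpha> p - int p"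
    using assms(2,3) by (intro theta.coeff_cong_of_landen_pair[OF int_coeffs_fps_theta3_sq int_coeffs_fps_theta2_sq_quarter refl])
  then show ?thesis
    using assms(3) by (simp add: \<alpha>_def)
qed

end
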